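(* Let $T$ be a tree with spread $k\ge 72$ and diameter at most $k^{3/2}/\sqrt{72}$. Then $T^3$ is stackable.
   Context: The spread of a tree is the minimum distance between two distinct leaves. $T^3=T\,\square\, T\,\square\, T$ is the Cartesian cube, where $G\,\square\, H$ has vertex set $V(G)\times V(H)$ and $(v,w)\sim(v',w')$ iff ($v=v'$ and $ww'\in E(H)$) or ($vv'\in E(G)$ and $w=w'$). Cup stacking on a finite connected graph: initially one cup on every vertex; a move takes all $r\ge1$ cups from a vertex $x$ onto a vertex $y\neq x$ that already carries at least one cup and satisfies $d(x,y)=r$ (shortest-path distance). The graph is stackable if for every vertex $t$ some sequence of moves ends with all cups on $t$. *)

theory Defs
  imports Complex_Main "Graph_Theory.Graph_Theory"
begin

text \<open>
  Finite simple graphs are represented by \<^locale>\<open>pair_graph\<close>: finite, loop-free digraphs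
  whose arc relation is symmetric, every edge being the pair of its two orientations.

  For such graphs the predicate \<^term>\<open>tree\<close> of the library is not the undirected
  notion: its cycles include the closed walks of length two that traverse one edge back and
  forth. The length bound below removes exactly these.
\<close>

definition is_tree :: "'a pair_pre_digraph \<Rightarrow> bool" where
  "is_tree G \<longleftrightarrow> pair_graph G \<and> Digraph_Component.connected (with_proj G) \<and>
     \<not> (\<exists>p. pre_digraph.cycle (with_proj G) p \<and> 3 \<le> length p)"

text \<open>Only meaningful for vertices of the same component.\<close>

definition graph_dist :: "'a pair_pre_digraph \<Rightarrow> 'a \<Rightarrow> 'a \<Rightarrow> nat" where
  "graph_dist G u v = (LEAST n. \<exists>p. pre_digraph.awalk (with_proj G) u p v \<and> length p = n)"

definition graph_diameter :: "'a pair_pre_digraph \<Rightarrow> nat" where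
  "graph_diameter G = Max {graph_dist G u v | u v. u \<in> pverts G \<and> v \<in> pverts G}"

definition leaf :: "'a pair_pre_digraph \<Rightarrow> 'a \<Rightarrow> bool" where
  "leaf G v \<longleftrightarrow> v \<in> pverts G \<and> out_degree (with_proj G) v = 1"

text \<open>The one-vertex tree has no leaves; it gets the value \<^term>\<open>Inf {} = (0::nat)\<close>.\<close>

definition spread :: "'a pair_pre_digraph \<Rightarrow> nat" where
  "spread G = Inf {graph_dist G u v | u v. leaf G u \<and> leaf G v \<and> u \<noteq> v}"

definition cart_prod ::
    "'a pair_pre_digraph \<Rightarrow> 'b pair_pre_digraph \<Rightarrow> ('a \<times> 'b) pair_pre_digraph"
    (infixr \<open>\<box>\<close> 70) where
  "G \<box> H =
     \<lparr> pverts = pverts G \<times> pverts H,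
       parcs = {((v, w), (v', w')) | v w v' w'.
                  (v \<in> pverts G \<and> v = v' \<and> (w, w') \<in> parcs H) \<or>
                  ((v, v') \<in> parcs G \<and> w \<in> pverts H \<and> w = w')} \<rparr>"

text \<open>A configuration assigns to each vertex the number of cups on it.\<close>

definition initial_cups :: "'a pair_pre_digraph \<Rightarrow> 'a \<Rightarrow> nat" where
  "initial_cups G v = (if v \<in> pverts G then 1 else 0)"

definition cup_move :: "'a pair_pre_digraph \<Rightarrow> ('a \<Rightarrow> nat) \<Rightarrow> ('a \<Rightarrow> nat) \<Rightarrow> bool" where
  "cup_move G c c' \<longleftrightarrow>
     (\<exists>x \<in> pverts G. \<exists>y \<in> pverts G. x \<noteq> y \<and> 1 \<le> c x \<and> 1 \<le> c y \<and>
        graph_dist G x y = c x \<and> c' = c(x := 0, y := c y + c x))"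

definition stackable :: "'a pair_pre_digraph \<Rightarrow> bool" where
  "stackable G \<longleftrightarrow>
     (\<forall>t \<in> pverts G. \<exists>c. (cup_move G)\<^sup>*\<^sup>* (initial_cups G) c \<and>
        (\<forall>v \<in> pverts G. v \<noteq> t \<longrightarrow> c v = 0))"

end

theory Submission
  imports Defs
begin

text \<open>
  A pile that has collected \<open>r\<close> vertices and stands at distance \<open>r\<close> from the target \<open>t\<close> can be
  moved onto \<open>t\<close>, so it suffices to partition the other vertices into sets of this kind. The
  vertices of a shortest path can be collected at any vertex of the path.

  Root \<open>T\<close> at a coordinate of \<open>t\<close>, and let every vertex prefer the child below which the nearest
  leaf lies. This partitions \<open>T\<close> into descending paths, and the bound on the spread makes all of
  them have at least \<open>k / 2\<close> vertices, with the possible exception of one short branch (the stub)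
  at the root. Fix a descending path with \<open>a\<close> vertices in one coordinate; its translates are lines,
  indexed by cells, that is, by the other two coordinates. Every line contains exactly one vertex
  whose distance from \<open>t\<close> is a multiple \<open>Q a\<close> of \<open>a\<close>, and that vertex can collect \<open>Q\<close> whole nearby lines.
  So the cells have to be partitioned into small clusters whose sizes are the demands \<open>Q\<close> of their
  roots. Cutting descendant-closed sets off a spanning tree of the cells leaves fewer than \<open>Q\<close> of
  them, and these are absorbed by a rectangle of cells reserved where the demand jumps from \<open>Q\<close>
  to \<open>Q + 1\<close>. Vertices with all coordinates near those of \<open>t\<close> lie on lines through the roots,
  which have demand one or can be moved directly.
\<close>

text \<open>The constants come from one balance. Let D be the diameter of \<open>T\<close> and h =
  (k + 1) div 2. Two distinct leaves give k \<le> D, so the hypothesis on D becomes 72 * D \<le> k *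
  k \<le> 4 * h * h; distances in the cube are at most 3 * D, hence at most h * h / 6. Lines away
  from the target are cut to lengths a with 3 * h / 4 \<le> a \<le> (3 * h + 1) / 2. A demand is a
  distance divided by a, hence at most a / 3, which keeps clusters narrow compared with their lines.
  For the reserved rectangle it is even at most 2 * h / 9 < h / 4, so the rectangle fits between two
  paths with h edges that leave the target. The obstacle is counting: nothing forces the demands of
  the chosen roots to add up to the number of cells. The jump of the demand supplies the freedom. On
  its two sides one may pick roots of demand Q or Q + 1, and their collecting vertices are the two
  ends of their lines, where lines up to distance a can be collected instead of about a / 2. Hence
  any partition with the right sizes works there.\<close>

section \<open>Collecting cups\<close>

text \<open>
  \<open>gather d A v\<close>: starting from one cup on every vertex of \<open>A\<close>, all these cups can be stacked on
  \<open>v\<close>, using only moves inside \<open>A\<close>. \<open>clearable d t S\<close>: the cups of \<open>S\<close> can be stacked on \<open>t\<close>, in such a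
  way that the last move of each goes directly onto \<open>t\<close>.
\<close>

inductive gather :: "('v \<Rightarrow> 'v \<Rightarrow> nat) \<Rightarrow> 'v set \<Rightarrow> 'v \<Rightarrow> bool" for d where
  single: "gather d {v} v"
| merge: "\<lbrakk>gather d A v; gather d B u; A \<inter> B = {}; d u v = card B\<rbrakk> \<Longrightarrow> gather d (A \<union> B) v"

inductive clearable :: "('v \<Rightarrow> 'v \<Rightarrow> nat) \<Rightarrow> 'v \<Rightarrow> 'v set \<Rightarrow> bool" for d t where
  empty: "clearable d t {}"
| add: "\<lbrakk>clearable d t S; gather d B u; S \<inter> B = {}; d u t = card B\<rbrakk> \<Longrightarrow> clearable d t (S \<union> B)"

lemma gather_finite: "gather d A v \<Longrightarrow> finite A"
  by (induction rule: gather.induct) auto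

lemma gather_mem: "gather d A v \<Longrightarrow> v \<in> A"
  by (induction rule: gather.induct) auto

lemma clearable_gather:
  assumes "gather d B u" "d u t = card B"
  shows "clearable d t B"
  using clearable.add[OF clearable.empty assms(1) _ assms(2)] by simp

lemma clearable_Un:
  assumes "clearable d t S" "clearable d t S'" "S \<inter> S' = {}"
  shows "clearable d t (S \<union> S')"
  using assms(2,1,3)
proof (induction rule: clearable.induct)
  case empty
  then show ?case by simp
next
  case (add S' B u)
  then have "clearable d t ((S \<union> S') \<union> B)"
    by (intro clearable.add[OF _ add.hyps(2)]) auto
  then show ?case by (simp add: Un_assoc)
qed

lemma clearable_UN:
  assumes "finite I" "\<And>i. i \<in> I \<Longrightarrow> clearable d t (S i)"
    and "\<And>i j. i \<in> I \<Longrightarrow> j \<in> I \<Longrightarrow> i \<noteq> j \<Longrightarrow> S i \<inter> S j = {}"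
  shows "clearable d t (\<Union>i\<in>I. S i)"
  using assms
proof (induction I rule: finite_induct)
  case empty
  then show ?case by (simp add: clearable.empty)
next
  case (insert i I)
  have "S i \<inter> (\<Union>j\<in>I. S j) = {}"
    using insert.prems(2) insert.hyps by fastforce
  then have "clearable d t (S i \<union> (\<Union>j\<in>I. S j))"
    using insert by (intro clearable_Un) auto
  then show ?case by simp
qed

lemma clearable_imp_gather:
  assumes "clearable d t S" "t \<notin> S"
  shows "gather d (insert t S) t"
  using assms
proof (induction rule: clearable.induct)
  case empty
  then show ?case by (simp add: gather.single)
next
  case (add S B u)
  then have "gather d (insert t S \<union> B) t"
    by (intro gather.merge[where u = u]) auto
  then show ?case by simp
qed

section \<open>Isometric paths\<close>

definition isometric :: "('v \<Rightarrow> 'v \<Rightarrow> nat) \<Rightarrow> (nat \<Rightarrow> 'v) \<Rightarrow> nat set \<Rightarrow> bool" where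
  "isometric d f I \<longleftrightarrow> (\<forall>i\<in>I. \<forall>j\<in>I. d (f i) (f j) = (i - j) + (j - i))"

lemma isometric_subset: "isometric d f I \<Longrightarrow> J \<subseteq> I \<Longrightarrow> isometric d f J"
  unfolding isometric_def by blast

lemma isometric_inj_on:
  assumes "isometric d f I"
  shows "inj_on f I"
proof (rule inj_onI)
  fix i j assume ij: "i \<in> I" "j \<in> I" "f i = f j"
  then have "d (f i) (f j) = 0" "d (f i) (f j) = (i - j) + (j - i)"
    using assms unfolding isometric_def by (metis diff_self_eq_0 add_0)+
  then show "i = j" by simp
qed

text \<open>The zigzag of the frog puzzle: the pile that swallowed all of a path but one end vertex
  sits at the other end, so it can jump onto the missing vertex.\<close>

lemma gather_path_ends:
  assumes "isometric d f {i..i + n}"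
  shows "gather d (f ` {i..i + n}) (f i) \<and> gather d (f ` {i..i + n}) (f (i + n))"
  using assms
proof (induction n arbitrary: i)
  case 0
  then show ?case by (simp add: gather.single)
next
  case (Suc n)
  have inj: "inj_on f {i..i + Suc n}" by (rule isometric_inj_on[OF Suc.prems])
  have 1: "gather d (f ` {Suc i..Suc i + n}) (f (Suc i + n))"
    using Suc.IH[of "Suc i"] isometric_subset[OF Suc.prems] by auto
  have 2: "gather d (f ` {i..i + n}) (f i)"
    using Suc.IH[of i] isometric_subset[OF Suc.prems] by auto
  have c: "card (f ` {Suc i..Suc i + n}) = Suc n" "card (f ` {i..i + n}) = Suc n"
    using inj by (auto simp: card_image inj_on_subset)
  have "gather d ({f i} \<union> f ` {Suc i..Suc i + n}) (f i)"
  proof (rule gather.merge[OF gather.single 1])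
    show "{f i} \<inter> f ` {Suc i..Suc i + n} = {}"
      using inj_onD[OF inj] by fastforce
    show "d (f (Suc i + n)) (f i) = card (f ` {Suc i..Suc i + n})"
      using Suc.prems c unfolding isometric_def by simp
  qed
  moreover have "{f i} \<union> f ` {Suc i..Suc i + n} = f ` {i..i + Suc n}"
    using atLeastAtMost_insertL[of i "i + Suc n"] by (metis add_Suc add_Suc_right image_insert insert_is_Un le_add1)
  moreover have "gather d ({f (i + Suc n)} \<union> f ` {i..i + n}) (f (i + Suc n))"
  proof (rule gather.merge[OF gather.single 2])
    show "{f (i + Suc n)} \<inter> f ` {i..i + n} = {}"
      using inj_onD[OF inj] by fastforce
    show "d (f i) (f (i + Suc n)) = card (f ` {i..i + n})"
      using Suc.prems c unfolding isometric_def by simp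
  qed
  moreover have "{f (i + Suc n)} \<union> f ` {i..i + n} = f ` {i..i + Suc n}"
    by (metis add_Suc_right atLeastAtMostSuc_conv image_insert insert_is_Un le_add1 le_SucI)
  ultimately show ?case by simp
qed

text \<open>Either side of \<open>f m\<close> is piled up at its far end, whose distance from
  \<open>f m\<close> is exactly the number of vertices on that side; so both piles can jump.\<close>

lemma gather_path:
  assumes "isometric d f {i..<j}" "i \<le> m" "m < j"
  shows "gather d (f ` {i..<j}) (f m)"
proof -
  have inj: "inj_on f {i..<j}" by (rule isometric_inj_on[OF assms(1)])
  have left: "gather d ({f m} \<union> f ` {i..<m}) (f m)"
  proof (cases "i = m")
    case True
    then show ?thesis by (simp add: gather.single)
  next
    case False
    then obtain n where n: "m = Suc (i + n)" using assms(2) by (metis less_iff_Suc_add order_le_imp_less_or_eq)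
    then have eq: "{i..<m} = {i..i + n}" by auto
    show ?thesis
    proof (rule gather.merge[OF gather.single])
      show "gather d (f ` {i..<m}) (f i)"
        unfolding eq using assms(3) n
        by (intro conjunct1[OF gather_path_ends] isometric_subset[OF assms(1)]) auto
      show "{f m} \<inter> f ` {i..<m} = {}" using inj_onD[OF inj] assms by fastforce
      have "card (f ` {i..<m}) = m - i"
        using assms(3) by (subst card_image[OF inj_on_subset[OF inj]]) auto
      then show "d (f i) (f m) = card (f ` {i..<m})"
        using assms unfolding isometric_def by auto
    qed
  qed
  have "gather d (({f m} \<union> f ` {i..<m}) \<union> f ` {Suc m..<j}) (f m)"
  proof (cases "Suc m = j")
    case True
    then show ?thesis using left by simp
  next
    case False
    then obtain n where n: "j = Suc (Suc m + n)" using assms(3) by (metis Suc_lessI less_iff_Suc_add)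
    then have eq: "{Suc m..<j} = {Suc m..Suc m + n}" by auto
    show ?thesis
    proof (rule gather.merge[OF left])
      show "gather d (f ` {Suc m..<j}) (f (Suc m + n))"
        unfolding eq using assms(2) n
        by (intro conjunct2[OF gather_path_ends] isometric_subset[OF assms(1)]) auto
      show "({f m} \<union> f ` {i..<m}) \<inter> f ` {Suc m..<j} = {}"
        using inj_onD[OF inj] assms by fastforce
      have "card (f ` {Suc m..<j}) = j - Suc m"
        using assms(2) by (subst card_image[OF inj_on_subset[OF inj]]) auto
      then show "d (f (Suc m + n)) (f m) = card (f ` {Suc m..<j})"
        using assms n unfolding isometric_def by auto
    qed
  qed
  moreover have "{i..<j} = {m} \<union> {i..<m} \<union> {Suc m..<j}" using assms by auto
  ultimately show ?thesis by (simp add: image_Un)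
qed

lemma clearable_path:
  assumes "isometric d f {i..<j}" "i \<le> m" "m < j" "d (f m) t = j - i"
  shows "clearable d t (f ` {i..<j})"
proof (rule clearable_gather[OF gather_path[OF assms(1-3)]])
  have "card (f ` {i..<j}) = j - i"
    using isometric_inj_on[OF assms(1)] by (simp add: card_image)
  then show "d (f m) t = card (f ` {i..<j})" using assms(4) by simp
qed

text \<open>The distance to \<open>t\<close> is smallest, namely \<open>r\<close>, at the bend
  \<open>l\<close>. For \<open>l < r\<close> the whole path can be piled up on the long side at
  distance \<open>l + L\<close>. For \<open>r < l\<close> the path is cut at the bend. For
  \<open>r = l\<close> the left part would need the bend itself as its collecting vertex, so the cut
  moves by one; \<open>l + 2 \<le> L\<close> is what the right part then requires.\<close>

lemma clearable_bent_path:
  fixes r l L :: nat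
  assumes iso: "isometric d f {0..<l + L}" and "l + 2 \<le> L" "1 \<le> r" "r \<le> l + L"
    and tgt: "\<And>i. i < l + L \<Longrightarrow> d (f i) t = r + ((i - l) + (l - i))"
  shows "clearable d t (f ` {0..<l + L})"
proof -
  consider "r < l" | "r = l" | "l < r" by linarith
  then show ?thesis
  proof cases
    case 1
    have "clearable d t (f ` {0..<l})"
      using 1 by (intro clearable_path[where m = r] isometric_subset[OF iso]) (auto simp: tgt)
    moreover have "clearable d t (f ` {l..<l + L})"
      using assms 1 by (intro clearable_path[where m = "l + (L - r)"] isometric_subset[OF iso]) (auto simp: tgt)
    moreover have "f ` {0..<l} \<inter> f ` {l..<l + L} = {}"
      using inj_onD[OF isometric_inj_on[OF iso]] by fastforce
    ultimately have "clearable d t (f ` {0..<l} \<union> f ` {l..<l + L})" by (rule clearable_Un)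
    moreover have "{0..<l + L} = {0..<l} \<union> {l..<l + L}" by auto
    ultimately show ?thesis by (metis image_Un)
  next
    case 2
    have "clearable d t (f ` {0..<Suc l})"
      using assms 2 by (intro clearable_path[where m = "l - 1"] isometric_subset[OF iso]) (auto simp: tgt)
    moreover have "clearable d t (f ` {Suc l..<l + L})"
      using assms 2 by (intro clearable_path[where m = "L - 1"] isometric_subset[OF iso]) (auto simp: tgt)
    moreover have "f ` {0..<Suc l} \<inter> f ` {Suc l..<l + L} = {}"
      using inj_onD[OF isometric_inj_on[OF iso]] assms by fastforce
    ultimately have "clearable d t (f ` {0..<Suc l} \<union> f ` {Suc l..<l + L})" by (rule clearable_Un)
    moreover have "{0..<l + L} = {0..<Suc l} \<union> {Suc l..<l + L}" using assms by auto
    ultimately show ?thesis by (metis image_Un)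
  next
    case 3
    then show ?thesis
      using assms by (intro clearable_path[where m = "l + (l + L - r)"]) (auto simp: tgt)
  qed
qed

section \<open>Clusters in spanning trees\<close>

locale clustering =
  fixes D :: "'c set" and r :: 'c and par :: "'c \<Rightarrow> 'c" and rank :: "'c \<Rightarrow> nat"
    and \<delta> :: "'c \<Rightarrow> 'c \<Rightarrow> nat" and Q :: "'c \<Rightarrow> nat" and q :: nat
  assumes fin: "finite D" and par_in: "w \<in> D \<Longrightarrow> par w \<in> D"
    and par_r: "par r = r"
    and rank_par: "w \<in> D \<Longrightarrow> w \<noteq> r \<Longrightarrow> rank (par w) < rank w"
    and \<delta>_refl: "\<delta> w w = 0" and \<delta>_sym: "\<delta> u w = \<delta> w u"
    and \<delta>_tri: "u \<in> D \<Longrightarrow> v \<in> D \<Longrightarrow> w \<in> D \<Longrightarrow> \<delta> u w \<le> \<delta> u v + \<delta> v w"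
    and \<delta>_par: "w \<in> D \<Longrightarrow> \<delta> w (par w) \<le> 1"
    and Q_pos: "w \<in> D \<Longrightarrow> 1 \<le> Q w" and Q_le: "w \<in> D \<Longrightarrow> Q w \<le> q"
    and Q_par: "w \<in> D \<Longrightarrow> Q w \<le> Q (par w) + 1"
begin

definition subtree :: "'c \<Rightarrow> 'c set" where
  "subtree v = {w \<in> D. \<exists>n. (par ^^ n) w = v}"

text \<open>These are the sets that can be cut off so that what remains is again a tree under the
  same parent function.\<close>

definition descendant_closed :: "'c set \<Rightarrow> bool" where
  "descendant_closed X \<longleftrightarrow> X \<subseteq> D \<and> (\<forall>w\<in>D. par w \<in> X \<longrightarrow> w \<in> X)"

lemma funpow_par_in: "w \<in> D \<Longrightarrow> (par ^^ n) w \<in> D"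
  by (induction n) (auto simp: par_in)

lemma subtree_subset: "subtree v \<subseteq> D"
  by (auto simp: subtree_def)

lemma finite_subtree: "finite (subtree v)"
  using fin subtree_subset by (rule rev_finite_subset)

lemma self_in_subtree: "v \<in> D \<Longrightarrow> v \<in> subtree v"
  unfolding subtree_def by (auto intro: exI[of _ 0])

lemma rank_mono:
  assumes "w \<in> subtree v"
  shows "rank v \<le> rank w"
proof -
  obtain n where n: "w \<in> D" "(par ^^ n) w = v" using assms by (auto simp: subtree_def)
  have "rank ((par ^^ n) w) \<le> rank w"
  proof (induction n)
    case (Suc n)
    have "(par ^^ n) w \<in> D" using n funpow_par_in by blast
    then have "rank (par ((par ^^ n) w)) \<le> rank ((par ^^ n) w)"
      using rank_par par_r by (metis order.strict_implies_order order_refl)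
    then show ?case using Suc by simp
  qed simp
  then show ?thesis using n by simp
qed

lemma descendant_closed_subtree: "descendant_closed (subtree v)"
  unfolding descendant_closed_def subtree_def
proof (intro conjI ballI impI)
  fix w assume "w \<in> D" "par w \<in> {w \<in> D. \<exists>n. (par ^^ n) w = v}"
  then obtain n where "(par ^^ n) (par w) = v" by auto
  then have "(par ^^ Suc n) w = v" by (simp add: funpow_swap1)
  then show "w \<in> {w \<in> D. \<exists>n. (par ^^ n) w = v}" using \<open>w \<in> D\<close> by blast
qed auto

lemma descendant_closed_subtree_minus:
  assumes "v \<in> D"
  shows "descendant_closed (subtree v - {v})"
  unfolding descendant_closed_def
proof (intro conjI ballI impI)
  fix w assume w: "w \<in> D" "par w \<in> subtree v - {v}"
  then have "w \<in> subtree v" using descendant_closed_subtree unfolding descendant_closed_def by blast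
  moreover have "w \<noteq> v"
  proof
    assume "w = v"
    then have "v \<noteq> r" using w par_r by auto
    then have "rank (par v) < rank v" using rank_par assms by blast
    moreover have "rank v \<le> rank (par v)" using w \<open>w = v\<close> rank_mono by auto
    ultimately show False by simp
  qed
  ultimately show "w \<in> subtree v - {v}" by simp
qed (use subtree_subset in blast)

lemma reach_root:
  assumes "w \<in> D"
  shows "\<exists>n. (par ^^ n) w = r"
  using assms
proof (induction "rank w" arbitrary: w rule: less_induct)
  case less
  show ?case
  proof (cases "w = r")
    case True
    then show ?thesis by (auto intro: exI[of _ 0])
  next
    case False
    then obtain n where "(par ^^ n) (par w) = r"
      using less rank_par par_in by blast
    then have "(par ^^ Suc n) w = r" by (simp add: funpow_swap1)
    then show ?thesis by blast
  qed
qed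

lemma subtree_root: "subtree r = D"
  using reach_root by (auto simp: subtree_def)

lemma descendant_closed_root_imp_all:
  assumes "descendant_closed X" "r \<in> X"
  shows "X = D"
proof -
  have "w \<in> X" if "w \<in> D" for w
    using that
  proof (induction "rank w" arbitrary: w rule: less_induct)
    case less
    then show ?case using assms rank_par par_in unfolding descendant_closed_def by (cases "w = r") blast+
  qed
  then show ?thesis using assms unfolding descendant_closed_def by blast
qed

text \<open>The path from \<open>w\<close> up to \<open>v\<close> stays in the subtree, and taking
  the least number of steps makes its vertices distinct.\<close>

lemma dist_subtree:
  assumes "w \<in> subtree v"
  shows "\<delta> w v + 1 \<le> card (subtree v)"
proof -
  define n where "n = (LEAST n. (par ^^ n) w = v)"
  have w: "w \<in> D" and ex: "\<exists>n. (par ^^ n) w = v" using assms by (auto simp: subtree_def)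
  have n: "(par ^^ n) w = v" unfolding n_def by (rule LeastI_ex[OF ex])
  have least: "(par ^^ m) w \<noteq> v" if "m < n" for m
    using that not_less_Least unfolding n_def by blast
  have shift: "(par ^^ (n - i)) ((par ^^ i) w) = v" if "i \<le> n" for i
    using that n by (metis comp_apply funpow_add le_add_diff_inverse2)
  have "inj_on (\<lambda>i. (par ^^ i) w) {..n}"
  proof (rule linorder_inj_onI)
    fix i j assume ij: "i < j" "i \<in> {..n}" "j \<in> {..n}"
    show "(par ^^ i) w \<noteq> (par ^^ j) w"
    proof
      assume "(par ^^ i) w = (par ^^ j) w"
      then have "(par ^^ (n - j)) ((par ^^ i) w) = v" using shift[of j] ij by simp
      then have "(par ^^ (n - j + i)) w = v" by (simp only: funpow_add comp_apply)
      moreover have "n - j + i < n" using ij by (simp add: less_diff_conv2)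
      ultimately show False using least by blast
    qed
  qed auto
  then have "card ((\<lambda>i. (par ^^ i) w) ` {..n}) = n + 1" by (simp add: card_image)
  moreover have "(\<lambda>i. (par ^^ i) w) ` {..n} \<subseteq> subtree v"
    using shift funpow_par_in[OF w] by (auto simp: subtree_def)
  ultimately have "n + 1 \<le> card (subtree v)" using card_mono[OF finite_subtree] by metis
  moreover have "\<delta> w ((par ^^ m) w) \<le> m" for m
  proof (induction m)
    case (Suc m)
    have "\<delta> w ((par ^^ Suc m) w) \<le> \<delta> w ((par ^^ m) w) + \<delta> ((par ^^ m) w) (par ((par ^^ m) w))"
      using \<delta>_tri w funpow_par_in par_in by simp
    also have "\<dots> \<le> m + 1" using Suc \<delta>_par[OF funpow_par_in[OF w]] by (meson add_mono)
    finally show ?case by simp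
  qed (simp add: \<delta>_refl)
  then have "\<delta> w v \<le> n" using n by metis
  ultimately show ?thesis by simp
qed

lemma child_above:
  assumes "w \<in> subtree v" "w \<noteq> v"
  shows "\<exists>c\<in>D. par c = v \<and> c \<noteq> v \<and> w \<in> subtree c"
proof -
  define n where "n = (LEAST n. (par ^^ n) w = v)"
  have w: "w \<in> D" and ex: "\<exists>n. (par ^^ n) w = v" using assms by (auto simp: subtree_def)
  have n: "(par ^^ n) w = v" unfolding n_def by (rule LeastI_ex[OF ex])
  then obtain m where m: "n = Suc m" using assms(2) by (cases n) auto
  have "m < (LEAST n. (par ^^ n) w = v)" using m unfolding n_def by simp
  then have "(par ^^ m) w \<noteq> v" by (rule not_less_Least)
  moreover have "par ((par ^^ m) w) = v" using n m by simp
  moreover have "(par ^^ m) w \<in> D" using funpow_par_in w by blast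
  moreover have "w \<in> subtree ((par ^^ m) w)" using w by (auto simp: subtree_def)
  ultimately show ?thesis by blast
qed

text \<open>A vertex of least rank in \<open>B - A\<close> has no child in \<open>A\<close> and no
  parent in \<open>B\<close>, so \<open>B\<close> can be shrunk one vertex at a time.\<close>

lemma descendant_closed_intermediate:
  assumes "descendant_closed A" "descendant_closed B" "A \<subseteq> B" "card A \<le> n" "n \<le> card B"
  shows "\<exists>X. descendant_closed X \<and> A \<subseteq> X \<and> X \<subseteq> B \<and> card X = n"
  using assms
proof (induction "card B - n" arbitrary: B)
  case 0
  then show ?case by (intro exI[of _ B]) auto
next
  case (Suc k)
  have finB: "finite B" using Suc.prems fin unfolding descendant_closed_def by (meson finite_subset)
  then have "finite (B - A)" by simp
  moreover have "B - A \<noteq> {}" using Suc by auto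
  ultimately obtain m where m: "m \<in> B - A" "\<And>x. x \<in> B - A \<Longrightarrow> rank m \<le> rank x"
    by (metis arg_min_if_finite(1,2) not_le_imp_less)
  have "descendant_closed (B - {m})" unfolding descendant_closed_def
  proof (intro conjI ballI impI)
    show "B - {m} \<subseteq> D" using Suc.prems unfolding descendant_closed_def by blast
    fix w assume w: "w \<in> D" "par w \<in> B - {m}"
    then have "w \<in> B" using Suc.prems unfolding descendant_closed_def by blast
    moreover have "w \<noteq> m"
    proof
      assume "w = m"
      then have "par m \<notin> A" using m Suc.prems(1) w unfolding descendant_closed_def by blast
      then have "rank m \<le> rank (par m)" using m w \<open>w = m\<close> by blast
      moreover have "m \<noteq> r" using w \<open>w = m\<close> par_r by auto
      ultimately show False using rank_par w \<open>w = m\<close> by fastforce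
    qed
    ultimately show "w \<in> B - {m}" by simp
  qed
  moreover have "card (B - {m}) = card B - 1" using m finB by simp
  ultimately have "\<exists>X. descendant_closed X \<and> A \<subseteq> X \<and> X \<subseteq> B - {m} \<and> card X = n"
    using Suc.prems Suc.hyps(2) m by (intro Suc.hyps(1)) auto
  then show ?case by blast
qed

text \<open>Take a deepest vertex \<open>v\<close> whose subtree is large enough for its own demand.
  All subtrees below it are smaller than their demands, hence shallow. Either \<open>v\<close> or
  one of its children can serve as the root \<open>u\<close>; this is where the demand must not grow
  by more than one from parent to child.\<close>

lemma cluster_exists:
  assumes "r \<in> D" "Q r \<le> card D"
  shows "\<exists>X u. descendant_closed X \<and> u \<in> X \<and> card X = Q u \<and> (\<forall>w\<in>X. \<delta> u w \<le> q)"
proof -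
  define S where "S = {v \<in> D. Q v \<le> card (subtree v)}"
  have "r \<in> S" using assms subtree_root by (simp add: S_def)
  moreover have "finite S" using fin by (simp add: S_def)
  ultimately have "finite (rank ` S)" "rank ` S \<noteq> {}" by auto
  then have "Max (rank ` S) \<in> rank ` S" using Max_in by blast
  then obtain v where v: "v \<in> S" "rank v = Max (rank ` S)" by auto
  have max: "rank x \<le> rank v" if "x \<in> S" for x
    using that v(2) \<open>finite (rank ` S)\<close> by simp
  have vD: "v \<in> D" and Qv: "Q v \<le> card (subtree v)" using v by (auto simp: S_def)
  have small: "card (subtree c) < Q c" if "c \<in> D" "par c = v" "c \<noteq> v" for c
  proof -
    have "c \<noteq> r" using that par_r by auto
    then have "rank v < rank c" using rank_par that by blast
    then show ?thesis using max that by (fastforce simp: S_def)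
  qed
  \<comment> \<open>A subtree hanging from \<open>v\<close> has fewer than \<open>q\<close>
    vertices, so depth at most \<open>q - 2\<close>; the edge to \<open>v\<close> adds one, and in
    \<open>near_c\<close> the way back down to \<open>c\<close> adds another.\<close>
  have near_v: "\<delta> v w + 1 \<le> q" if wv: "w \<in> subtree v" for w
  proof (cases "w = v")
    case True
    then show ?thesis using Q_pos[OF vD] Q_le[OF vD] by (simp add: \<delta>_refl)
  next
    case False
    then obtain c where c: "c \<in> D" "par c = v" "c \<noteq> v" "w \<in> subtree c"
      using child_above[OF wv] by blast
    have "\<delta> w c + 1 \<le> card (subtree c)" by (rule dist_subtree[OF c(4)])
    then have "\<delta> w c + 2 \<le> q" using small[OF c(1-3)] Q_le[OF c(1)] by linarith
    moreover have "\<delta> w v \<le> \<delta> w c + \<delta> c v" using \<delta>_tri[OF _ c(1) vD] subtree_subset wv by blast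
    moreover have "\<delta> c v \<le> 1" using \<delta>_par[OF c(1)] c(2) by simp
    ultimately show ?thesis by (simp add: \<delta>_sym[of v w])
  qed
  have near_c: "\<delta> c w \<le> q" if "c \<in> D" "par c = v" "w \<in> subtree v" for c w
  proof -
    have "\<delta> c w \<le> \<delta> c v + \<delta> v w" using \<delta>_tri[OF that(1) vD] subtree_subset that(3) by blast
    moreover have "\<delta> c v \<le> 1" using \<delta>_par[OF that(1)] that(2) by simp
    ultimately show ?thesis using near_v[OF that(3)] by linarith
  qed
  \<comment> \<open>If the subtree of \<open>v\<close> is too big for \<open>v\<close>, a child
    \<open>c\<close> becomes the root. Its cluster avoids \<open>v\<close> if its demand is less
    than the size of the whole subtree. Otherwise the demand of \<open>c\<close> is at least that
    size and at most \<open>Q v + 1\<close>, hence equal to it, and the whole subtree is the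
    cluster.\<close>
  consider "card (subtree v) = Q v"
    | c where "Q v < card (subtree v)" "c \<in> D" "par c = v" "c \<noteq> v" "Q c \<le> card (subtree v) - 1"
    | "Q v < card (subtree v)" "\<And>c. c \<in> D \<Longrightarrow> par c = v \<Longrightarrow> c \<noteq> v \<Longrightarrow> card (subtree v) - 1 < Q c"
    using Qv by (metis le_neq_implies_less not_le_imp_less)
  then show ?thesis
  proof cases
    case 1
    then show ?thesis
      using descendant_closed_subtree self_in_subtree[OF vD] near_v by (intro exI[of _ "subtree v"] exI[of _ v]) fastforce
  next
    case (2 c)
    have "subtree c \<subseteq> subtree v - {v}"
    proof
      fix w assume w: "w \<in> subtree c"
      then obtain n where n: "w \<in> D" "(par ^^ n) w = c" by (auto simp: subtree_def)
      then have "(par ^^ Suc n) w = v" using 2 by simp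
      then have "w \<in> subtree v" using n by (auto simp only: subtree_def mem_Collect_eq)
      moreover have "w \<noteq> v"
      proof
        assume "w = v"
        then have "rank c \<le> rank v" using rank_mono w by simp
        moreover have "c \<noteq> r" using 2 par_r by auto
        ultimately show False using rank_par[of c] 2 by simp
      qed
      ultimately show "w \<in> subtree v - {v}" by simp
    qed
    moreover have "card (subtree v - {v}) = card (subtree v) - 1"
      using self_in_subtree[OF vD] finite_subtree by simp
    ultimately obtain X where X: "descendant_closed X" "subtree c \<subseteq> X" "X \<subseteq> subtree v - {v}" "card X = Q c"
      using descendant_closed_intermediate[OF descendant_closed_subtree descendant_closed_subtree_minus[OF vD], of c "Q c"] small[OF 2(2-4)] 2(5)
      by auto
    then show ?thesis
      using self_in_subtree[OF 2(2)] near_c[OF 2(2,3)] by (intro exI[of _ X] exI[of _ c]) auto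
  next
    case 3
    have "1 \<le> Q v" using Q_pos vD by blast
    then have "card (subtree v) \<noteq> card {v}" using 3(1) by simp
    then obtain w where "w \<in> subtree v" "w \<noteq> v" using self_in_subtree[OF vD] by (metis is_singletonI' is_singleton_def singletonD empty_iff)
    then obtain c where c: "c \<in> D" "par c = v" "c \<noteq> v" "w \<in> subtree c" using child_above by blast
    have "Q c \<le> Q v + 1" using Q_par[OF c(1)] c(2) by simp
    then have "card (subtree v) = Q c" using 3(1) 3(2)[OF c(1-3)] by linarith
    moreover have "c \<in> subtree v" using c by (auto simp: subtree_def intro: exI[of _ 1])
    ultimately show ?thesis
      using descendant_closed_subtree near_c[OF c(1,2)] by (intro exI[of _ "subtree v"] exI[of _ c]) auto
  qed
qed

end

text \<open>\<open>G\<close> stands for the property of being already handled, closed under adding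
  an admissible cluster. Clusters are cut off until fewer than \<open>Q r\<close> vertices remain;
  the remainder is still a tree at \<open>r\<close>, so its size bounds its radius.\<close>

lemma clusters_up_to_remainder:
  assumes "clustering D r par rank \<delta> Q q" "r \<in> D \<or> D = {}" "1 \<le> Q r"
    and G: "\<And>S X u. \<lbrakk>G S; S \<inter> X = {}; X \<subseteq> C; u \<in> X; card X = Q u; \<forall>w\<in>X. \<delta> u w \<le> q\<rbrakk> \<Longrightarrow> G (S \<union> X)"
    and "D \<subseteq> C" "G (C - D)"
  shows "\<exists>R\<subseteq>C. card R < Q r \<and> finite R \<and> (\<forall>w\<in>R. \<delta> w r + 1 \<le> card R) \<and> G (C - R)"
  using assms(1,2,5,6)
proof (induction "card D" arbitrary: D rule: less_induct)
  case less
  interpret clustering D r par rank \<delta> Q q by (rule less.prems)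
  show ?case
  proof (cases "D = {} \<or> card D < Q r")
    case True
    have "\<forall>w\<in>D. \<delta> w r + 1 \<le> card D" using dist_subtree subtree_root by metis
    moreover have "card D < Q r" using True assms(3) by auto
    ultimately show ?thesis using less.prems fin by blast
  next
    case False
    then have rD: "r \<in> D" using less.prems by blast
    then obtain X u where X: "descendant_closed X" "u \<in> X" "card X = Q u" "\<forall>w\<in>X. \<delta> u w \<le> q"
      using cluster_exists False by (meson not_le_imp_less)
    have XD: "X \<subseteq> D" using X unfolding descendant_closed_def by blast
    have "G (C - D \<union> X)"
      using X XD less.prems by (intro G) auto
    moreover have "C - D \<union> X = C - (D - X)" using XD less.prems by blast
    ultimately have "G (C - (D - X))" by simp
    moreover have "clustering (D - X) r par rank \<delta> Q q"
    proof
      show "par w \<in> D - X" if "w \<in> D - X" for w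
        using that X(1) par_in unfolding descendant_closed_def by blast
    qed (use fin par_r rank_par \<delta>_refl \<delta>_sym \<delta>_tri \<delta>_par Q_pos Q_le Q_par in auto)
    moreover have "r \<in> D - X \<or> D - X = {}" using descendant_closed_root_imp_all[OF X(1)] rD by blast
    moreover have "card (D - X) < card D"
      using X XD fin by (intro psubset_card_mono) auto
    ultimately show ?thesis using less.hyps[of "D - X"] less.prems by blast
  qed
qed

text \<open>Breadth-first search: the parent is the predecessor on a shortest walk from
  \<open>r\<close>.\<close>

lemma spanning_tree_exists:
  fixes R :: "'c rel"
  assumes "\<And>w. w \<in> C \<Longrightarrow> (r, w) \<in> R\<^sup>*" and "R \<subseteq> C \<times> C" "r \<in> C"
  obtains par :: "'c \<Rightarrow> 'c" and rank :: "'c \<Rightarrow> nat" where "par r = r"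
    "\<And>w. w \<in> C \<Longrightarrow> w \<noteq> r \<Longrightarrow> (par w, w) \<in> R \<and> rank (par w) < rank w"
proof -
  define rank where "rank = (\<lambda>w. LEAST n. (r, w) \<in> R ^^ n)"
  have rank: "(r, w) \<in> R ^^ rank w" if "w \<in> C" for w
    using assms(1)[OF that] unfolding rank_def rtrancl_power by (rule LeastI_ex)
  have "\<exists>p. (p, w) \<in> R \<and> rank p < rank w" if wC: "w \<in> C" and wr: "w \<noteq> r" for w
  proof -
    obtain n where n: "rank w = Suc n" using rank[OF wC] wr by (cases "rank w") auto
    then obtain p where p: "(r, p) \<in> R ^^ n" "(p, w) \<in> R" using rank[OF wC] by auto
    have "rank p \<le> n" unfolding rank_def using p(1) by (rule Least_le)
    then show ?thesis using p n by auto
  qed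
  then obtain par where par: "\<And>w. w \<in> C \<Longrightarrow> w \<noteq> r \<Longrightarrow> (par w, w) \<in> R \<and> rank (par w) < rank w"
    by metis
  show ?thesis
    by (rule that[of "par(r := r)" rank]) (use par in auto)
qed

section \<open>Bundles of parallel lines\<close>

text \<open>\<open>\<phi> i w\<close> is the vertex at height \<open>i\<close> on the line over the
  cell \<open>w\<close>. Heights are measured away from the target, \<open>e\<close> is the offset
  of height 0, and \<open>lev\<close> is the distance of a cell from the cell of the target.\<close>

locale line_bundle =
  fixes d :: "'v \<Rightarrow> 'v \<Rightarrow> nat" and t :: 'v and \<phi> :: "nat \<Rightarrow> 'c \<Rightarrow> 'v"
    and a e :: nat and C :: "'c set" and \<delta> :: "'c \<Rightarrow> 'c \<Rightarrow> nat" and lev :: "'c \<Rightarrow> nat"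
  assumes dist_\<phi>: "\<lbrakk>w \<in> C; w' \<in> C; i < a; j < a\<rbrakk> \<Longrightarrow> d (\<phi> i w) (\<phi> j w') = (i - j) + (j - i) + \<delta> w w'"
    and dist_t: "\<lbrakk>w \<in> C; i < a\<rbrakk> \<Longrightarrow> d (\<phi> i w) t = e + i + lev w"
    and \<delta>_refl: "\<delta> w w = 0" and \<delta>_sym: "\<delta> u w = \<delta> w u"
    and \<delta>_pos: "\<lbrakk>u \<in> C; w \<in> C; u \<noteq> w\<rbrakk> \<Longrightarrow> 1 \<le> \<delta> u w"
    and \<delta>_tri: "\<lbrakk>u \<in> C; v \<in> C; w \<in> C\<rbrakk> \<Longrightarrow> \<delta> u w \<le> \<delta> u v + \<delta> v w"
    and lev_lip: "\<lbrakk>u \<in> C; w \<in> C\<rbrakk> \<Longrightarrow> lev u \<le> lev w + \<delta> u w"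
    and finC: "finite C"
begin

definition line :: "'c \<Rightarrow> 'v set" where
  "line w = (\<lambda>i. \<phi> i w) ` {0..<a}"

definition lines :: "'c set \<Rightarrow> 'v set" where
  "lines X = (\<Union>w\<in>X. line w)"

lemma isometric_line: "w \<in> C \<Longrightarrow> isometric d (\<lambda>i. \<phi> i w) {0..<a}"
  by (auto simp: isometric_def dist_\<phi> \<delta>_refl)

lemma card_line: "w \<in> C \<Longrightarrow> card (line w) = a"
  unfolding line_def using isometric_inj_on[OF isometric_line] by (simp add: card_image)

lemma line_disjoint:
  assumes "u \<in> C" "w \<in> C" "u \<noteq> w"
  shows "line u \<inter> line w = {}"
proof -
  have False if "i < a" "j < a" "\<phi> i u = \<phi> j w" for i j
  proof -
    have "(i - i) + (i - i) + \<delta> u u = (i - j) + (j - i) + \<delta> u w"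
      using dist_\<phi>[OF assms(1) assms(1) that(1,1)] dist_\<phi>[OF assms(1,2) that(1,2)] that(3) by simp
    then show False using \<delta>_pos[OF assms] by (simp add: \<delta>_refl)
  qed
  then show ?thesis by (auto simp: line_def)
qed

lemma lines_disjoint: "\<lbrakk>X \<subseteq> C; Y \<subseteq> C; X \<inter> Y = {}\<rbrakk> \<Longrightarrow> lines X \<inter> lines Y = {}"
  unfolding lines_def using line_disjoint by fastforce

lemma lines_Un: "lines (X \<union> Y) = lines X \<union> lines Y"
  by (auto simp: lines_def)

lemma finite_line: "finite (line w)"
  by (simp add: line_def)

lemma card_lines:
  assumes "X \<subseteq> C"
  shows "card (lines X) = card X * a"
proof -
  have "card (lines X) = (\<Sum>w\<in>X. card (line w))"
    unfolding lines_def
  proof (rule card_UN_disjoint)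
    show "finite X" using assms finC by (rule finite_subset)
    show "\<forall>u\<in>X. \<forall>w\<in>X. u \<noteq> w \<longrightarrow> line u \<inter> line w = {}" using line_disjoint assms by blast
  qed (simp add: finite_line)
  also have "\<dots> = (\<Sum>w\<in>X. a)" using assms card_line by (intro sum.cong) auto
  finally show ?thesis by simp
qed

text \<open>A sufficient condition for a pile at height \<open>x\<close> to swallow a line at cell
  distance \<open>n\<close>. The first two alternatives leave room for a vertex of that line, above
  or below height \<open>x\<close>, at distance exactly \<open>a\<close> from the pile; the third
  leaves room for cutting the line.\<close>

definition feeds :: "nat \<Rightarrow> nat \<Rightarrow> bool" where
  "feeds x n \<longleftrightarrow> n \<le> a \<and> (x < n \<or> a \<le> x + n \<or> 2 * n + 2 \<le> a)"

text \<open>Unless the whole line can be piled up at distance \<open>a\<close> from the vertex of height \<open>x\<close>,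
  it is cut at height \<open>x + 1\<close> or \<open>x\<close> into two paths, each of which can be piled up at the right
  distance.\<close>

lemma gather_feed:
  assumes A: "gather d A (\<phi> x u)" and x: "x < a" and u: "u \<in> C" and w: "w \<in> C" and "u \<noteq> w"
    and feeds: "feeds x (\<delta> u w)" and disj: "A \<inter> line w = {}"
  shows "gather d (A \<union> line w) (\<phi> x u)"
proof -
  define n where "n = \<delta> u w"
  have n: "1 \<le> n" "n \<le> a" using \<delta>_pos[OF u w \<open>u \<noteq> w\<close>] feeds by (auto simp: n_def feeds_def)
  let ?f = "\<lambda>i. \<phi> i w"
  have iso: "isometric d ?f {i..<j}" if "j \<le> a" for i j
    using that by (intro isometric_subset[OF isometric_line[OF w]]) auto
  have card: "card (?f ` {i..<j}) = j - i" if "j \<le> a" for i j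
    using isometric_inj_on[OF iso[OF that]] by (simp add: card_image)
  have dist: "d (\<phi> i w) (\<phi> x u) = (i - x) + (x - i) + n" if "i < a" for i
    using dist_\<phi>[OF w u that x] by (simp add: n_def \<delta>_sym)
  have whole: ?thesis if "i < a" "(i - x) + (x - i) + n = a" for i
  proof (rule gather.merge[OF A _ disj])
    show "gather d (line w) (\<phi> i w)"
      unfolding line_def using that by (intro gather_path iso) auto
    show "d (\<phi> i w) (\<phi> x u) = card (line w)" using dist that card_line[OF w] by simp
  qed
  have split: ?thesis if s: "s \<le> a" "i < s" "(i - x) + (x - i) + n = s"
    "s \<le> j" "j < a" "(j - x) + (x - j) + n = a - s" for s i j
  proof -
    have inj: "inj_on ?f {0..<a}" by (rule isometric_inj_on[OF iso]) simp
    have eq: "line w = ?f ` {0..<s} \<union> ?f ` {s..<a}"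
      using s(1) by (metis ivl_disj_un_two(3) image_Un le0 line_def)
    have "?f ` {0..<s} \<inter> ?f ` {s..<a} = {}"
      using inj_onD[OF inj] s(1) by fastforce
    have "gather d (A \<union> ?f ` {0..<s}) (\<phi> x u)"
    proof (rule gather.merge[OF A])
      show "gather d (?f ` {0..<s}) (\<phi> i w)" using s by (intro gather_path iso) auto
      show "A \<inter> ?f ` {0..<s} = {}" using disj eq by auto
      show "d (\<phi> i w) (\<phi> x u) = card (?f ` {0..<s})" using s dist card by simp
    qed
    then have "gather d ((A \<union> ?f ` {0..<s}) \<union> ?f ` {s..<a}) (\<phi> x u)"
    proof (rule gather.merge)
      show "gather d (?f ` {s..<a}) (\<phi> j w)" using s by (intro gather_path iso) auto
      show "(A \<union> ?f ` {0..<s}) \<inter> ?f ` {s..<a} = {}"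
        using disj eq \<open>?f ` {0..<s} \<inter> ?f ` {s..<a} = {}\<close> by auto
      show "d (\<phi> j w) (\<phi> x u) = card (?f ` {s..<a})" using s dist card by simp
    qed
    then show ?thesis by (simp add: eq Un_assoc)
  qed
  consider "x < n" | "a \<le> x + n" | "n \<le> x" "x + n + 2 \<le> a" "2 * n + 2 \<le> a"
    | "x + n + 1 = a" "2 * n + 2 \<le> a"
    using feeds unfolding feeds_def n_def[symmetric] by linarith
  then show ?thesis
  proof cases
    case 1
    then show ?thesis using n by (intro whole[of "x + a - n"]) auto
  next
    case 2
    then show ?thesis using n x by (intro whole[of "x + n - a"]) auto
  next
    case 3
    then show ?thesis using n by (intro split[of "x + 1" "n - 1" "a - 1 - n"]) auto
  next
    case 4
    then show ?thesis using n by (intro split[of x n "a - n"]) auto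
  qed
qed

lemma clearable_cluster:
  assumes X: "X \<subseteq> C" and u: "u \<in> X" and x: "x < a" and size: "card X * a = e + x + lev u"
    and feeds: "\<And>w. w \<in> X \<Longrightarrow> w \<noteq> u \<Longrightarrow> feeds x (\<delta> u w)"
  shows "clearable d t (lines X)"
proof -
  have uC: "u \<in> C" using u X by blast
  have fin: "finite X" using X finC by (rule finite_subset)
  have "gather d (line u \<union> lines Y) (\<phi> x u)" if "Y \<subseteq> X - {u}" for Y
  proof -
    have "finite Y" using that fin by (meson finite_Diff finite_subset)
    then show ?thesis using that
    proof (induction Y rule: finite_induct)
      case empty
      have "gather d (line u) (\<phi> x u)"
        unfolding line_def using x by (intro gather_path isometric_line uC) auto
      then show ?case by (simp add: lines_def)
    next
      case (insert w Y)
      have w: "w \<in> C" "w \<noteq> u" "w \<in> X" using insert.prems X by auto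
      have "lines (insert u Y) \<inter> lines {w} = {}"
        using insert X w uC by (intro lines_disjoint) auto
      then have "gather d ((line u \<union> lines Y) \<union> line w) (\<phi> x u)"
        using insert w feeds
        by (intro gather_feed x uC) (auto simp: lines_def)
      moreover have "(line u \<union> lines Y) \<union> line w = line u \<union> lines (insert w Y)"
        by (auto simp: lines_def)
      ultimately show ?case by simp
    qed
  qed
  from this[of "X - {u}"] have "gather d (line u \<union> lines (X - {u})) (\<phi> x u)" by simp
  moreover have "line u \<union> lines (X - {u}) = lines X" using u by (auto simp: lines_def)
  ultimately have "gather d (lines X) (\<phi> x u)" by simp
  moreover have "d (\<phi> x u) t = card (lines X)"
    using dist_t[OF uC x] card_lines[OF X] size by simp
  ultimately show ?thesis by (rule clearable_gather)
qed

lemma clearable_lines_Un: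
  assumes "X \<subseteq> C" "Y \<subseteq> C" "X \<inter> Y = {}" "clearable d t (lines X)" "clearable d t (lines Y)"
  shows "clearable d t (lines (X \<union> Y))"
  unfolding lines_Un by (rule clearable_Un[OF assms(4,5) lines_disjoint[OF assms(1-3)]])

text \<open>The two sizes say that the collecting vertex has height 0 or \<open>a - 1\<close>. From
  an end of the line, any other line within cell distance \<open>a\<close> can be collected
  uncut.\<close>

lemma clearable_cluster_at_ends:
  assumes X: "X \<subseteq> C" and u: "u \<in> X" and "0 < a"
    and size: "card X * a = e + lev u \<or> card X * a + 1 = e + a + lev u"
    and near: "\<And>w. w \<in> X \<Longrightarrow> \<delta> u w \<le> a"
  shows "clearable d t (lines X)"
proof -
  have pos: "1 \<le> \<delta> u w" if "w \<in> X" "w \<noteq> u" for w using \<delta>_pos X u that by blast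
  show ?thesis
  proof (cases "card X * a = e + lev u")
    case True
    then show ?thesis
      using assms pos by (intro clearable_cluster[where x = 0 and u = u]) (auto simp: feeds_def Suc_le_eq)
  next
    case False
    then show ?thesis
      using assms pos by (intro clearable_cluster[where x = "a - 1" and u = u]) (auto simp: feeds_def)
  qed
qed

text \<open>\<open>demand w\<close> is the number of lines that must be collected at the vertex of line \<open>w\<close> whose
  distance from \<open>t\<close> is a multiple of \<open>a\<close>.\<close>

definition demand :: "'c \<Rightarrow> nat" where
  "demand w = (e + lev w + a - 1) div a"

lemma demand_bounds:
  assumes "0 < a"
  shows "e + lev w \<le> demand w * a" "demand w * a < e + lev w + a"
proof -
  have "e + lev w + a - 1 = demand w * a + (e + lev w + a - 1) mod a"
    unfolding demand_def by simp
  moreover have "(e + lev w + a - 1) mod a < a" using assms by simp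
  ultimately show "e + lev w \<le> demand w * a" "demand w * a < e + lev w + a"
    using assms by linarith+
qed

lemma demand_le:
  assumes "0 < a" "e + lev w \<le> m * a"
  shows "demand w \<le> m"
proof -
  have "demand w * a < (m + 1) * a" using demand_bounds[OF assms(1), of w] assms(2) by simp
  then show ?thesis using assms(1) by (simp only: mult_less_cancel2) linarith
qed

text \<open>The position of the collecting vertex on its line is not under control here. The bound
  \<open>2 * q + 2 \<le> a\<close> makes every position feasible, since clusters have radius at most
  \<open>q\<close>.\<close>

lemma clearable_up_to_remainder:
  assumes conn: "\<And>w. w \<in> K \<Longrightarrow> (r, w) \<in> {(u, v). u \<in> K \<and> v \<in> K \<and> \<delta> u v = 1}\<^sup>*"
    and K: "K \<subseteq> C" "r \<in> K"
    and pos: "\<And>w. w \<in> K \<Longrightarrow> 1 \<le> e + lev w"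
    and q: "\<And>w. w \<in> K \<Longrightarrow> demand w \<le> q" "2 * q + 2 \<le> a"
  shows "\<exists>R\<subseteq>K. card R < demand r \<and> (\<forall>w\<in>R. \<delta> w r + 1 \<le> card R) \<and> clearable d t (lines (K - R))"
proof -
  have a: "0 < a" using q(2) by simp
  obtain par rank where par: "par r = r"
    "\<And>w. w \<in> K \<Longrightarrow> w \<noteq> r \<Longrightarrow> (par w, w) \<in> {(u, v). u \<in> K \<and> v \<in> K \<and> \<delta> u v = 1} \<and> rank (par w) < (rank w :: nat)"
    by (rule spanning_tree_exists[OF conn _ K(2)]) auto
  have par1: "par w \<in> K \<and> \<delta> w (par w) \<le> 1" if "w \<in> K" for w
    using par that K(2) \<delta>_refl \<delta>_sym by (cases "w = r") fastforce+
  have dpos: "1 \<le> demand w" if "w \<in> K" for w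
    using demand_bounds(1)[OF a, of w] pos[OF that] by (cases "demand w") auto
  have clust: "clustering K r par rank \<delta> demand q"
  proof
    show "finite K" using K(1) finC by (rule finite_subset)
    \<comment> \<open>One step changes the level by at most one, which is at most
      \<open>a\<close>.\<close>
    show "demand w \<le> demand (par w) + 1" if "w \<in> K" for w
    proof (rule demand_le[OF a])
      have "lev w \<le> lev (par w) + 1"
        using lev_lip[of w "par w"] par1[OF that] that K(1) by fastforce
      then show "e + lev w \<le> (demand (par w) + 1) * a"
        using demand_bounds(1)[OF a, of "par w"] a by (simp add: algebra_simps)
    qed
    show "\<delta> u w \<le> \<delta> u v + \<delta> v w" if "u \<in> K" "v \<in> K" "w \<in> K" for u v w
      using \<delta>_tri that K(1) by blast
  qed (use par par1 \<delta>_refl \<delta>_sym dpos q(1) in auto)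
  have "\<exists>R\<subseteq>K. card R < demand r \<and> finite R \<and> (\<forall>w\<in>R. \<delta> w r + 1 \<le> card R) \<and>
      (\<lambda>S. S \<subseteq> K \<and> clearable d t (lines S)) (K - R)"
  proof (rule clusters_up_to_remainder[OF clust])
    show "1 \<le> demand r" using dpos K(2) by blast
    fix S X u
    assume S: "S \<subseteq> K \<and> clearable d t (lines S)" "S \<inter> X = {}" and X: "X \<subseteq> K" "u \<in> X"
      "card X = demand u" "\<forall>w\<in>X. \<delta> u w \<le> q"
    have "clearable d t (lines X)"
    proof (rule clearable_cluster[where x = "demand u * a - (e + lev u)"])
      show "X \<subseteq> C" "u \<in> X" using X K by auto
      show "demand u * a - (e + lev u) < a" "card X * a = e + (demand u * a - (e + lev u)) + lev u"
        using demand_bounds[OF a, of u] X(3) by auto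
      show "feeds (demand u * a - (e + lev u)) (\<delta> u w)" if "w \<in> X" for w
        using X(4) that q(2) by (auto simp: feeds_def)
    qed
    then show "S \<union> X \<subseteq> K \<and> clearable d t (lines (S \<union> X))"
      using S X K by (auto intro!: clearable_lines_Un)
  qed (use K clearable.empty in \<open>auto simp: lines_def\<close>)
  then show ?thesis by blast
qed

text \<open>Every cell of \<open>W\<close> is within reach of every root, so the cells can be handed
  out arbitrarily; only the sizes matter.\<close>

lemma clearable_roots:
  assumes "finite U" "U \<subseteq> W" "W \<subseteq> C" "0 < a"
    and "card W = (\<Sum>u\<in>U. k u)"
    and "\<And>u. u \<in> U \<Longrightarrow> 1 \<le> k u \<and> (k u * a = e + lev u \<or> k u * a + 1 = e + a + lev u)"
    and "\<And>u w. u \<in> U \<Longrightarrow> w \<in> W \<Longrightarrow> \<delta> u w \<le> a"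
  shows "clearable d t (lines W)"
  using assms
proof (induction U arbitrary: W rule: finite_induct)
  case empty
  then have "finite W" using finC by (metis finite_subset)
  then have "W = {}" using empty by simp
  then show ?case by (simp add: lines_def clearable.empty)
next
  case (insert u U)
  have finW: "finite W" by (rule finite_subset[OF insert.prems(2) finC])
  \<comment> \<open>Each remaining root must keep its own cell. As all sizes are at least one,
    enough other cells are left to fill the cluster of \<open>u\<close>.\<close>
  have "card U \<le> (\<Sum>u\<in>U. k u)"
    using sum_mono[of U "\<lambda>_. 1" k] insert.prems by auto
  then have "k u \<le> card (W - U)"
    using insert finW by (subst card_Diff_subset) auto
  then have "k u - 1 \<le> card (W - insert u U)"
    using insert finW by (simp add: card_Diff_insert)
  then obtain Y where Y: "Y \<subseteq> W - insert u U" "card Y = k u - 1"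
    by (metis obtain_subset_with_card_n)
  have finY: "finite Y" using Y finW by (meson finite_Diff finite_subset)
  have "u \<notin> Y" using Y by blast
  then have card: "card (insert u Y) = k u" using Y(2) finY insert.prems(5)[of u] by simp
  have "clearable d t (lines (insert u Y))"
  proof (rule clearable_cluster_at_ends)
    show "card (insert u Y) * a = e + lev u \<or> card (insert u Y) * a + 1 = e + a + lev u"
      unfolding card using insert.prems(5) by blast
  qed (use Y insert.prems in auto)
  moreover have "clearable d t (lines (W - insert u Y))"
  proof (rule insert.IH)
    show "card (W - insert u Y) = (\<Sum>u\<in>U. k u)"
      using insert Y card finY by (subst card_Diff_subset) auto
    show "U \<subseteq> W - insert u Y" using insert.hyps(2) insert.prems(1) Y(1) by blast
  qed (use insert.prems in auto)
  moreover have "W = insert u Y \<union> (W - insert u Y)" using Y(1) insert.prems(1) by blast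
  moreover have "insert u Y \<subseteq> C" "W - insert u Y \<subseteq> C" "insert u Y \<inter> (W - insert u Y) = {}"
    using Y(1) insert.prems(1,2) by auto
  ultimately show ?case using clearable_lines_Un by metis
qed

end

section \<open>Cells in a product of two trees\<close>

locale finite_metric =
  fixes V :: "'a set" and d :: "'a \<Rightarrow> 'a \<Rightarrow> nat"
  assumes finV: "finite V"
    and d_refl: "d x x = 0" and d_sym: "d x y = d y x"
    and d_pos: "\<lbrakk>x \<in> V; y \<in> V; x \<noteq> y\<rbrakk> \<Longrightarrow> 1 \<le> d x y"
    and d_tri: "\<lbrakk>x \<in> V; y \<in> V; z \<in> V\<rbrakk> \<Longrightarrow> d x z \<le> d x y + d y z"
begin

definition connected_in :: "'a set \<Rightarrow> bool" where
  "connected_in A \<longleftrightarrow> (\<forall>x\<in>A. \<forall>y\<in>A. (x, y) \<in> {(u, v). u \<in> A \<and> v \<in> A \<and> d u v = 1}\<^sup>*)"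

definition d2 :: "'a \<times> 'a \<Rightarrow> 'a \<times> 'a \<Rightarrow> nat" where
  "d2 w w' = d (fst w) (fst w') + d (snd w) (snd w')"

end

text \<open>The cells are pairs of coordinates and \<open>(s, s')\<close> is the cell of the target.
  It need not belong to \<open>A \<times> B\<close>, since \<open>A\<close> or \<open>B\<close> may
  be a stub.\<close>

locale grid_bundle = finite_metric V d for V :: "'a set" and d +
  fixes D :: "'v \<Rightarrow> 'v \<Rightarrow> nat" and t :: 'v and \<phi> :: "nat \<Rightarrow> 'a \<times> 'a \<Rightarrow> 'v"
    and a e :: nat and A B :: "'a set" and s s' :: 'a and \<Delta> :: nat
  assumes AB: "A \<subseteq> V" "B \<subseteq> V" and s: "s \<in> V" "s' \<in> V"
    and conn: "connected_in A" "connected_in B"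
    and D_\<phi>: "\<lbrakk>w \<in> A \<times> B; w' \<in> A \<times> B; i < a; j < a\<rbrakk> \<Longrightarrow>
      D (\<phi> i w) (\<phi> j w') = (i - j) + (j - i) + d2 w w'"
    and D_t: "\<lbrakk>w \<in> A \<times> B; i < a\<rbrakk> \<Longrightarrow> D (\<phi> i w) t = e + i + d2 w (s, s')"
    and \<Delta>: "\<lbrakk>w \<in> A \<times> B; i < a\<rbrakk> \<Longrightarrow> e + i + d2 w (s, s') \<le> \<Delta>"
begin

sublocale line_bundle D t \<phi> a e "A \<times> B" d2 "\<lambda>w. d2 w (s, s')"
proof
  show "d2 u w \<le> d2 u v + d2 v w" if "u \<in> A \<times> B" "v \<in> A \<times> B" "w \<in> A \<times> B" for u v w
    using that AB d_tri[of "fst u" "fst v" "fst w"] d_tri[of "snd u" "snd v" "snd w"]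
    by (auto simp: d2_def subset_iff)
  show "d2 u (s, s') \<le> d2 w (s, s') + d2 u w" if "u \<in> A \<times> B" "w \<in> A \<times> B" for u w
    using that AB s d_tri[of "fst u" "fst w" s] d_tri[of "snd u" "snd w" s']
    by (auto simp: d2_def subset_iff)
  show "1 \<le> d2 u w" if "u \<in> A \<times> B" "w \<in> A \<times> B" "u \<noteq> w" for u w
    using that AB d_pos[of "fst u" "fst w"] d_pos[of "snd u" "snd w"]
    by (auto simp: d2_def subset_iff prod_eq_iff)
  show "finite (A \<times> B)" using AB finV by (auto intro: finite_subset)
  show "d2 u w = d2 w u" for u w by (simp add: d2_def d_sym)
qed (auto simp: D_\<phi> D_t d2_def d_refl)

text \<open>Rows over points outside \<open>S\<close> and columns over points outside
  \<open>S'\<close> are intact. Each cell of the complement lies on one of these, and the column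
  over \<open>z1\<close> links the intact rows.\<close>

lemma rectangle_complement_connected:
  assumes "y0 \<in> A" "z0 \<in> B" "y0 \<notin> S" and z1: "z1 \<in> B" "z1 \<notin> S'"
    and w: "w \<in> A \<times> B - S \<times> S'"
  defines "K \<equiv> A \<times> B - S \<times> S'"
  shows "((y0, z0), w) \<in> {(u, v). u \<in> K \<and> v \<in> K \<and> d2 u v = 1}\<^sup>*" (is "_ \<in> ?E\<^sup>*")
proof -
  have row: "((y, z), (y, z')) \<in> ?E\<^sup>*" if y: "y \<in> A" "y \<notin> S" and z: "z \<in> B" "z' \<in> B" for y z z'
  proof -
    have "(z, z') \<in> {(u, v). u \<in> B \<and> v \<in> B \<and> d u v = 1}\<^sup>*"
      using conn(2) z unfolding connected_in_def by blast
    then show ?thesis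
    proof (induction rule: rtrancl_induct)
      case (step b c)
      then have "((y, b), (y, c)) \<in> ?E" using y by (auto simp: K_def d2_def d_refl)
      then show ?case using step.IH by (meson rtrancl.rtrancl_into_rtrancl)
    qed simp
  qed
  have col: "((y, z), (y', z)) \<in> ?E\<^sup>*" if y: "y \<in> A" "y' \<in> A" and z: "z \<in> B" "z \<notin> S'" for y y' z
  proof -
    have "(y, y') \<in> {(u, v). u \<in> A \<and> v \<in> A \<and> d u v = 1}\<^sup>*"
      using conn(1) y unfolding connected_in_def by blast
    then show ?thesis
    proof (induction rule: rtrancl_induct)
      case (step b c)
      then have "((b, z), (c, z)) \<in> ?E" using z by (auto simp: K_def d2_def d_refl)
      then show ?case using step.IH by (meson rtrancl.rtrancl_into_rtrancl)
    qed simp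
  qed
  obtain y z where yz: "w = (y, z)" "y \<in> A" "z \<in> B" "y \<notin> S \<or> z \<notin> S'" using w by auto
  show ?thesis
  proof (cases "z \<in> S'")
    case True
    then have "y \<notin> S" using yz by blast
    have "((y0, z0), (y0, z1)) \<in> ?E\<^sup>*" using assms by (intro row) auto
    also have "((y0, z1), (y, z1)) \<in> ?E\<^sup>*" using assms yz by (intro col) auto
    also have "((y, z1), (y, z)) \<in> ?E\<^sup>*" using \<open>y \<notin> S\<close> assms yz by (intro row) auto
    finally show ?thesis using yz by simp
  next
    case False
    have "((y0, z0), (y0, z)) \<in> ?E\<^sup>*" using assms yz by (intro row) auto
    also have "((y0, z), (y, z)) \<in> ?E\<^sup>*" using False assms yz by (intro col) auto
    finally show ?thesis using yz by simp
  qed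
qed

text \<open>The collecting vertex of \<open>w\<close> really lies on its line, so its distance
  \<open>demand w * a\<close> is bounded by \<open>\<Delta>\<close> without any rounding
  loss.\<close>

lemma demand_third:
  assumes "w \<in> A \<times> B" "0 < a" "3 * \<Delta> \<le> a * a"
  shows "3 * demand w \<le> a"
proof -
  have b: "e + d2 w (s, s') \<le> demand w * a" "demand w * a < e + d2 w (s, s') + a"
    using demand_bounds[OF assms(2)] by blast+
  define x where "x = demand w * a - (e + d2 w (s, s'))"
  have "x < a" using b assms(2) by (simp add: x_def)
  then have "e + x + d2 w (s, s') \<le> \<Delta>" using \<Delta> assms(1) by blast
  then have "demand w * a \<le> \<Delta>" using b by (simp add: x_def)
  then have "(3 * demand w) * a \<le> a * a" using assms(3) by linarith
  then show ?thesis using assms(2) by simp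
qed

lemma remainder_exists:
  assumes "y0 \<in> A" "z0 \<in> B" "y0 \<notin> S" "B - S' \<noteq> {}"
    and "12 \<le> a" "3 * \<Delta> \<le> a * a"
    and "\<And>w. w \<in> A \<times> B - S \<times> S' \<Longrightarrow> 1 \<le> e + d2 w (s, s')"
  shows "\<exists>R\<subseteq>A \<times> B - S \<times> S'. card R < demand (y0, z0) \<and>
      (\<forall>w\<in>R. d2 w (y0, z0) + 1 \<le> card R) \<and> clearable D t (lines (A \<times> B - S \<times> S' - R))"
proof (rule clearable_up_to_remainder)
  show "demand w \<le> a div 3" if "w \<in> A \<times> B - S \<times> S'" for w
    using demand_third[of w] that assms(5,6) by fastforce
  show "2 * (a div 3) + 2 \<le> a" using assms(5) by linarith
  obtain z1 where "z1 \<in> B" "z1 \<notin> S'" using assms(4) by blast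
  then show "((y0, z0), w) \<in> {(u, v). u \<in> A \<times> B - S \<times> S' \<and> v \<in> A \<times> B - S \<times> S' \<and> d2 u v = 1}\<^sup>*"
    if "w \<in> A \<times> B - S \<times> S'" for w
    using rectangle_complement_connected assms(1-3) that by blast
qed (use assms in auto)

text \<open>With a root of demand one the remainder of the clustering has no room to be
  nonempty.\<close>

lemma clearable_near_target:
  assumes "y0 \<in> A" "z0 \<in> B" "y0 \<notin> S" "B - S' \<noteq> {}"
    and "12 \<le> a" "3 * \<Delta> \<le> a * a"
    and "\<And>w. w \<in> A \<times> B - S \<times> S' \<Longrightarrow> 1 \<le> e + d2 w (s, s')"
    and "e + d2 (y0, z0) (s, s') \<le> a"
  shows "clearable D t (lines (A \<times> B - S \<times> S'))"
proof -
  obtain R where R: "R \<subseteq> A \<times> B - S \<times> S'" "card R < demand (y0, z0)"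
      "clearable D t (lines (A \<times> B - S \<times> S' - R))"
    using remainder_exists[OF assms(1-7)] by blast
  have "demand (y0, z0) \<le> 1" using assms(5,8) by (intro demand_le) auto
  moreover have "finite R" using R(1) finC by (meson Diff_subset finite_subset)
  moreover have "card R = 0" using R(2) calculation(1) by linarith
  ultimately have "R = {}" by simp
  then show ?thesis using R(3) by simp
qed

text \<open>A rectangle of \<open>Q (Q - 1)\<close> cells that straddles the sphere of cells whose demand jumps
  from \<open>Q\<close> to \<open>Q + 1\<close> is reserved. It absorbs the at most \<open>Q - 1\<close> cells that are left over by the
  clustering of the other cells, because
  \<open>Q (Q - 1) + m = (Q - 1 - m) Q + m (Q + 1)\<close>.\<close>

lemma clearable_far_from_target:
  assumes h: "36 \<le> h" "3 * h \<le> 4 * a" "2 * a \<le> 3 * h + 1" "6 * \<Delta> \<le> h * h" and e: "1 \<le> e"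
    and p: "\<And>i. i \<le> h \<Longrightarrow> p i \<in> A \<and> d (p i) s = i" "isometric d p {0..h}"
    and p': "\<And>i. i \<le> h \<Longrightarrow> p' i \<in> B \<and> d (p' i) s' = i" "isometric d p' {0..h}"
  shows "clearable D t (lines (A \<times> B))"
proof -
  have a12: "12 \<le> a" using h by linarith
  then have a0: "0 < a" by simp
  have "9 * (h * h) \<le> 16 * (a * a)" using mult_le_mono[OF h(2) h(2)] by simp
  then have \<Delta>a: "3 * \<Delta> \<le> a * a" using h(4) by linarith
  \<comment> \<open>The least level from \<open>h div 4\<close> on with \<open>e + \<kappa>\<close>
    a multiple of \<open>a\<close>. On level \<open>\<kappa>\<close> the demand is \<open>Q\<close>,
    collected at height 0; on level \<open>\<kappa> + 1\<close> it is \<open>Q + 1\<close>,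
    collected at height \<open>a - 1\<close>.\<close>
  define \<kappa> where "\<kappa> = h div 4 + (a - 1 - (e + h div 4 + a - 1) mod a)"
  have \<kappa>: "h div 4 \<le> \<kappa>" "\<kappa> < h div 4 + a" using a0 by (auto simp: \<kappa>_def)
  define Q where "Q = (e + h div 4 + a - 1) div a"
  have "e + h div 4 + a - 1 = Q * a + (e + h div 4 + a - 1) mod a"
    unfolding Q_def by simp
  moreover have "(e + h div 4 + a - 1) mod a \<le> a - 1" using a0 by (simp add: less_Suc_eq_le[symmetric])
  ultimately have Qa: "Q * a = e + \<kappa>" using e a0 unfolding \<kappa>_def by linarith
  have Q1: "1 \<le> Q" using Qa e by (cases Q) auto
  have \<kappa>h: "\<kappa> \<le> 2 * h" using \<kappa>(2) h(3) by linarith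
  \<comment> \<open>Level \<open>\<kappa>\<close> is not empty: walk along \<open>p\<close> as far
    as possible and make up the difference along \<open>p'\<close>.\<close>
  have Q\<Delta>: "Q * a \<le> \<Delta>"
  proof -
    have "p (min \<kappa> h) \<in> A \<and> d (p (min \<kappa> h)) s = min \<kappa> h" by (rule p(1)) simp
    moreover have "p' (\<kappa> - min \<kappa> h) \<in> B \<and> d (p' (\<kappa> - min \<kappa> h)) s' = \<kappa> - min \<kappa> h"
      using \<kappa>h by (intro p'(1)) auto
    ultimately have "e + 0 + \<kappa> \<le> \<Delta>"
      using \<Delta>[of "(p (min \<kappa> h), p' (\<kappa> - min \<kappa> h))" 0] a0 by (auto simp: d2_def)
    then show ?thesis using Qa by simp
  qed
  then have "(3 * Q) * a \<le> a * a" using \<Delta>a by linarith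
  then have Q3: "3 * Q \<le> a" using a0 by simp
  \<comment> \<open>Thus \<open>Q\<close> is at most 2 * h / 9. Compared with the lower bound
    \<open>h div 4\<close> on \<open>\<kappa>\<close>, this keeps a rectangle with sides
    \<open>Q\<close> and \<open>Q - 1\<close> within the coordinates available around level
    \<open>\<kappa>\<close>.\<close>
  have "18 * Q * h \<le> 6 * Q * (4 * a)" using mult_le_mono2[OF h(2), of "6 * Q"] by simp
  also have "\<dots> \<le> 4 * h * h" using Q\<Delta> h(4) by simp
  finally have Q9: "18 * Q \<le> 4 * h" using h(1) by simp
  \<comment> \<open>The corner \<open>(y1, z1)\<close> is placed as far along \<open>p\<close> as
    possible, with \<open>y1 + z1 = \<kappa> + 2 - Q\<close>. Then the two longest antidiagonals of
    the rectangle, with \<open>Q - 1\<close> cells each, lie on the levels \<open>\<kappa>\<close>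
    and \<open>\<kappa> + 1\<close>. The upper bound on \<open>a\<close> limits
    \<open>\<kappa>\<close> so that the other side fits into \<open>p'\<close>.\<close>
  define y1 where "y1 = min (\<kappa> + 2 - Q) (h + 1 - Q)"
  define z1 where "z1 = \<kappa> + 2 - Q - y1"
  have yz: "1 \<le> y1" "y1 + Q \<le> h + 1" "z1 + Q \<le> h + 1" "y1 + z1 + Q = \<kappa> + 2"
    using \<kappa> Q9 h unfolding y1_def z1_def by linarith+
  define S where "S = p ` {y1..<y1 + Q}"
  define S' where "S' = p' ` {z1..<z1 + (Q - 1)}"
  have inj: "inj_on p {0..h}" "inj_on p' {0..h}"
    using isometric_inj_on p(2) p'(2) by blast+
  have eqp: "p i = p j \<longleftrightarrow> i = j" "p' i = p' j \<longleftrightarrow> i = j" if "i \<le> h" "j \<le> h" for i j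
    using inj that by (auto dest: inj_onD)
  have SA: "S \<subseteq> A" "S' \<subseteq> B" using p(1) p'(1) yz by (auto simp: S_def S'_def)
  have cardS: "card S = Q" "card S' = Q - 1"
    using yz by (auto simp: S_def S'_def intro!: card_image[THEN trans] inj_on_subset[OF inj(1)] inj_on_subset[OF inj(2)])
  \<comment> \<open>The spanning tree is rooted right beside the corner of the rectangle. Its level
    is at most \<open>\<kappa>\<close>, so fewer than \<open>Q\<close> cells are left over, and they
    stay close to the rectangle.\<close>
  define r where "r = (p (y1 - 1), p' z1)"
  have rAB: "p (y1 - 1) \<in> A" "p' z1 \<in> B" using p(1)[of "y1 - 1"] p'(1)[of z1] yz Q1 by auto
  have r1: "p (y1 - 1) \<notin> S" using yz Q1 eqp(1) by (auto simp: S_def)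
  have "p' (z1 + (Q - 1)) \<in> B - S'" using yz Q1 eqp(2) p'(1) by (auto simp: S'_def)
  then have "B - S' \<noteq> {}" by blast
  from remainder_exists[OF rAB r1 this a12 \<Delta>a] e obtain R where R: "R \<subseteq> A \<times> B - S \<times> S'"
      "card R < demand r" "\<forall>w\<in>R. d2 w r + 1 \<le> card R" "clearable D t (lines (A \<times> B - S \<times> S' - R))"
    unfolding r_def by force
  have "d2 r (s, s') + Q = \<kappa> + 1"
    using p(1)[of "y1 - 1"] p'(1)[of z1] yz Q1 by (simp add: r_def d2_def)
  then have "demand r \<le> Q" using Qa Q1 a0 by (intro demand_le) auto
  define m where "m = card R"
  have m: "m < Q" using R(2) \<open>demand r \<le> Q\<close> by (simp add: m_def)
  \<comment> \<open>\<open>u0\<close> and \<open>u1\<close> enumerate the two antidiagonals. One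
    root is taken for each \<open>i < Q - 1\<close>; taking \<open>m\<close> of them from the higher
    level adds exactly \<open>m\<close> to the total demand.\<close>
  define u0 where "u0 = (\<lambda>i. (p (y1 + i), p' (z1 + Q - 2 - i)))"
  define u1 where "u1 = (\<lambda>i. (p (y1 + i + 1), p' (z1 + Q - 2 - i)))"
  define U where "U = u0 ` {0..<Q - 1 - m} \<union> u1 ` {0..<m}"
  have lev0: "d2 (u0 i) (s, s') = \<kappa>" if "i < Q - 1" for i
    using that p(1)[of "y1 + i"] p'(1)[of "z1 + Q - 2 - i"] yz by (simp add: u0_def d2_def)
  have lev1: "d2 (u1 i) (s, s') = \<kappa> + 1" if "i < Q - 1" for i
    using that p(1)[of "y1 + i + 1"] p'(1)[of "z1 + Q - 2 - i"] yz by (simp add: u1_def d2_def)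
  have uZ: "u0 i \<in> S \<times> S'" "u1 i \<in> S \<times> S'" if "i < Q - 1" for i
  proof -
    have "z1 + Q - 2 - i \<in> {z1..<z1 + (Q - 1)}" using that by auto
    then have "p' (z1 + Q - 2 - i) \<in> S'" unfolding S'_def by (rule imageI)
    moreover have "p (y1 + i) \<in> S" "p (y1 + i + 1) \<in> S"
      unfolding S_def using that by (intro imageI; simp)+
    ultimately show "u0 i \<in> S \<times> S'" "u1 i \<in> S \<times> S'" by (auto simp: u0_def u1_def)
  qed
  have UZ: "U \<subseteq> S \<times> S'" 
    unfolding U_def using uZ m by (intro Un_least image_subsetI) simp_all
  have inj0: "inj_on u0 {0..<Q - 1 - m}" "inj_on u1 {0..<m}"
    using yz m eqp(1) by (auto simp: inj_on_def u0_def u1_def)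
  have lm0: "\<forall>u\<in>u0 ` {0..<Q - 1 - m}. d2 u (s, s') = \<kappa>" using lev0 by auto
  have lm1: "\<forall>u\<in>u1 ` {0..<m}. d2 u (s, s') = \<kappa> + 1" using lev1 m by auto
  define k where "k = (\<lambda>u. if d2 u (s, s') = \<kappa> then Q else Q + 1)"
  have "sum k U = sum k (u0 ` {0..<Q - 1 - m}) + sum k (u1 ` {0..<m})"
    unfolding U_def
  proof (rule sum.union_disjoint)
    show "u0 ` {0..<Q - 1 - m} \<inter> u1 ` {0..<m} = {}"
      using lm0 lm1 by (metis disjoint_iff n_not_Suc_n Suc_eq_plus1)
  qed simp_all
  also have "sum k (u0 ` {0..<Q - 1 - m}) = (Q - 1 - m) * Q"
    using inj0(1) lev0 by (simp add: k_def sum.reindex)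
  also have "sum k (u1 ` {0..<m}) = m * (Q + 1)"
    using inj0(2) lev1 m by (simp add: k_def sum.reindex)
  also have "(Q - 1 - m) * Q + m * (Q + 1) = Q * (Q - 1) + m"
  proof -
    obtain n where "Q = Suc (m + n)" using m less_iff_Suc_add by blast
    then show ?thesis by (simp add: algebra_simps)
  qed
  finally have sumk: "sum k U = Q * (Q - 1) + m" .
  have finR: "finite R" using R(1) finC by (meson Diff_subset finite_subset)
  have finZ: "finite (S \<times> S')" by (simp add: S_def S'_def)
  \<comment> \<open>A leftover cell is within \<open>Q - 2\<close> of \<open>r\<close>. Passing
    through \<open>r\<close>, the distance from a root to it is below \<open>3 * Q\<close>, and
    \<open>3 * Q \<le> a\<close>.\<close>
  have near_r: "d2 u r \<le> 2 * Q - 2" "d2 u w \<le> 2 * Q" if u: "u \<in> S \<times> S'" and w: "w \<in> S \<times> S'" for u w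
  proof -
    obtain i j where ij: "u = (p i, p' j)" "y1 \<le> i" "i < y1 + Q" "z1 \<le> j" "j < z1 + (Q - 1)"
      using u by (auto simp: S_def S'_def)
    obtain i' j' where ij': "w = (p i', p' j')" "y1 \<le> i'" "i' < y1 + Q" "z1 \<le> j'" "j' < z1 + (Q - 1)"
      using w by (auto simp: S_def S'_def)
    have "d (p i) (p (y1 - 1)) = (i - (y1 - 1)) + (y1 - 1 - i)" "d (p' j) (p' z1) = (j - z1) + (z1 - j)"
      "d (p i) (p i') = (i - i') + (i' - i)" "d (p' j) (p' j') = (j - j') + (j' - j)"
      using p(2) p'(2) ij ij' yz unfolding isometric_def by auto
    moreover have "(i - (y1 - 1)) + (y1 - 1 - i) \<le> Q" "(j - z1) + (z1 - j) + 2 \<le> Q"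
      "(i - i') + (i' - i) \<le> Q" "(j - j') + (j' - j) \<le> Q"
      using ij ij' yz(1) by linarith+
    ultimately show "d2 u r \<le> 2 * Q - 2" "d2 u w \<le> 2 * Q"
      unfolding d2_def r_def ij(1) ij'(1) fst_conv snd_conv by linarith+
  qed
  have "clearable D t (lines (S \<times> S' \<union> R))"
  proof (rule clearable_roots[where U = U and k = k])
    show "finite U" by (simp add: U_def)
    show "U \<subseteq> S \<times> S' \<union> R" using UZ by blast
    show "S \<times> S' \<union> R \<subseteq> A \<times> B" using SA R(1) by blast
    have "card (S \<times> S' \<union> R) = card (S \<times> S') + card R"
      using R(1) finR finZ by (intro card_Un_disjoint) auto
    then show "card (S \<times> S' \<union> R) = sum k U"
      by (simp add: sumk card_cartesian_product cardS m_def)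
    show "1 \<le> k u \<and> (k u * a = e + d2 u (s, s') \<or> k u * a + 1 = e + a + d2 u (s, s'))" if "u \<in> U" for u
      using that lev0 lev1 m Q1 Qa by (auto simp: U_def k_def)
    show "d2 u w \<le> a" if u: "u \<in> U" and w: "w \<in> S \<times> S' \<union> R" for u w
    proof (cases "w \<in> S \<times> S'")
      case True
      then show ?thesis using near_r(2)[OF subsetD[OF UZ u] True] Q3 by linarith
    next
      case False
      then have wR: "w \<in> R" using w by blast
      then have "d2 w r + 1 \<le> m" using R(3) by (simp add: m_def)
      moreover have "d2 u r \<le> 2 * Q - 2" by (rule near_r(1)[OF subsetD[OF UZ u] subsetD[OF UZ u]])
      moreover have "d2 u w \<le> d2 u r + d2 r w"
        using UZ u SA R(1) wR rAB by (intro \<delta>_tri) (auto simp: r_def)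
      ultimately show ?thesis using m Q3 \<delta>_sym[of r w] by linarith
    qed
  qed (rule a0)
  then have "clearable D t (lines ((S \<times> S' \<union> R) \<union> (A \<times> B - S \<times> S' - R)))"
    by (rule clearable_lines_Un[OF _ _ _ _ R(4), rotated 3]) (use R(1) SA in auto)
  moreover have "(S \<times> S' \<union> R) \<union> (A \<times> B - S \<times> S' - R) = A \<times> B" using R(1) SA by blast
  ultimately show ?thesis by simp
qed

end

lemma (in grid_bundle) sub_bundle:
  assumes "i0 + b \<le> a"
  shows "grid_bundle V d D t (\<lambda>i. \<phi> (i0 + i)) b (e + i0) A B s s' \<Delta>"
proof
  show "D (\<phi> (i0 + i) w) t = e + i0 + i + d2 w (s, s')" if "w \<in> A \<times> B" "i < b" for w i
    using D_t[of w "i0 + i"] that assms by simp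
  show "e + i0 + i + d2 w (s, s') \<le> \<Delta>" if "w \<in> A \<times> B" "i < b" for w i
    using \<Delta>[of w "i0 + i"] that assms by simp
qed (use AB s conn D_\<phi> assms in auto)

text \<open>Longer lines are cut into segments of admissible length. A segment is again a bundle,
  with its starting height added to \<open>e\<close>.\<close>

lemma (in grid_bundle) clearable_long_lines:
  assumes "36 \<le> h" "3 * h \<le> 4 * a" "6 * \<Delta> \<le> h * h" "1 \<le> e"
    and "\<And>i. i \<le> h \<Longrightarrow> p i \<in> A \<and> d (p i) s = i" "isometric d p {0..h}"
    and "\<And>i. i \<le> h \<Longrightarrow> p' i \<in> B \<and> d (p' i) s' = i" "isometric d p' {0..h}"
  shows "clearable D t (lines (A \<times> B))"
proof -
  \<comment> \<open>\<open>g\<close> is 3 * h / 4 rounded up. Segments have between \<open>g\<close>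
    and \<open>2 * g - 1\<close> vertices, and twice the latter is at most
    \<open>3 * h + 1\<close>.\<close>
  define g where "g = (3 * h + 3) div 4"
  have g: "3 * h \<le> 4 * g" "4 * g \<le> 3 * h + 3" "0 < g" unfolding g_def using assms(1) by linarith+
  have "clearable D t ((\<lambda>(i, w). \<phi> i w) ` ({i0..<i0 + b} \<times> (A \<times> B)))" if "i0 + b \<le> a" "g \<le> b" for i0 b
    using that
  proof (induction b arbitrary: i0 rule: less_induct)
    case (less b)
    show ?case
    proof (cases "b < 2 * g")
      case True
      interpret sub: grid_bundle V d D t "\<lambda>i. \<phi> (i0 + i)" b "e + i0" A B s s' \<Delta>
        by (rule sub_bundle[OF less.prems(1)])
      have "clearable D t (sub.lines (A \<times> B))"
        using True g less.prems assms by (intro sub.clearable_far_from_target[of h p p']) auto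
      moreover have "sub.lines (A \<times> B) = (\<lambda>(i, w). \<phi> i w) ` ({i0..<i0 + b} \<times> (A \<times> B))"
      proof -
        have "(\<lambda>i. \<phi> (i0 + i) w) ` {0..<b} = (\<lambda>i. \<phi> i w) ` {i0..<i0 + b}" for w
          using image_image[of "\<lambda>i. \<phi> i w" "(+) i0" "{0..<b}"] by (simp add: add.commute)
        then show ?thesis by (auto simp: sub.lines_def sub.line_def)
      qed
      ultimately show ?thesis by simp
    next
      case False
      let ?I = "{i0..<i0 + g}" and ?J = "{i0 + g..<i0 + g + (b - g)}"
      let ?f = "\<lambda>(i, w). \<phi> i w"
      have "clearable D t (?f ` (?I \<times> (A \<times> B)))" "clearable D t (?f ` (?J \<times> (A \<times> B)))"
        using False g less.prems by (intro less.IH; simp)+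
      moreover have "?f ` (?I \<times> (A \<times> B)) \<inter> ?f ` (?J \<times> (A \<times> B)) = {}"
      proof -
        have False if "i \<in> ?I" "j \<in> ?J" "w \<in> A \<times> B" "w' \<in> A \<times> B" "\<phi> i w = \<phi> j w'" for i j w w'
        proof -
          have ia: "i < a" "j < a" using that less.prems False by auto
          have "D (\<phi> i w) (\<phi> i w) = 0" using D_\<phi>[OF that(3,3) ia(1,1)] by (simp add: d2_def d_refl)
          moreover have "D (\<phi> i w) (\<phi> j w') = (i - j) + (j - i) + d2 w w'"
            using D_\<phi>[OF that(3,4) ia] .
          ultimately show False using that(1,2,5) by auto
        qed
        then show ?thesis by fastforce
      qed
      ultimately have "clearable D t (?f ` (?I \<times> (A \<times> B)) \<union> ?f ` (?J \<times> (A \<times> B)))"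
        by (rule clearable_Un)
      moreover have "{i0..<i0 + b} = ?I \<union> ?J" using False by auto
      ultimately show ?thesis by (simp only: Sigma_Un_distrib1 image_Un)
    qed
  qed
  from this[of 0 a] have "clearable D t ((\<lambda>(i, w). \<phi> i w) ` ({0..<a} \<times> (A \<times> B)))"
    using g assms(2) by simp
  moreover have "(\<lambda>(i, w). \<phi> i w) ` ({0..<a} \<times> (A \<times> B)) = lines (A \<times> B)"
    by (auto simp: lines_def line_def)
  ultimately show ?thesis by simp
qed

section \<open>Path decomposition of trees\<close>

text \<open>Powers of the edge relation replace arc lists, so that concatenating and projecting
  walks become facts about relations. \<open>graph_dist_eq_rdist\<close> gives the agreement with
  \<open>graph_dist\<close>.\<close>

definition rdist :: "'a rel \<Rightarrow> 'a \<Rightarrow> 'a \<Rightarrow> nat" where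
  "rdist E u v = (LEAST n. (u, v) \<in> E ^^ n)"

lemma rdist_le: "(u, v) \<in> E ^^ n \<Longrightarrow> rdist E u v \<le> n"
  unfolding rdist_def by (rule Least_le)

lemma rdist_relpow: "(u, v) \<in> E\<^sup>* \<Longrightarrow> (u, v) \<in> E ^^ rdist E u v"
  unfolding rdist_def rtrancl_power by (rule LeastI_ex)

lemma rdist_refl: "rdist E u u = 0"
  using rdist_le[of u u 0 E] by simp

lemma rdist_sym:
  assumes "sym E"
  shows "rdist E u v = rdist E v u"
proof -
  have "(v, u) \<in> E ^^ n" if "(u, v) \<in> E ^^ n" for n u v
    using that
  proof (induction n arbitrary: v)
    case (Suc n)
    then obtain w where "(u, w) \<in> E ^^ n" "(w, v) \<in> E" by auto
    then show ?case using Suc.IH assms by (meson relpow_Suc_I2 symD)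
  qed simp
  then have "(u, v) \<in> E ^^ n \<longleftrightarrow> (v, u) \<in> E ^^ n" for n by blast
  then show ?thesis unfolding rdist_def by simp
qed

lemma rdist_triangle:
  assumes "(u, v) \<in> E\<^sup>*" "(v, w) \<in> E\<^sup>*"
  shows "rdist E u w \<le> rdist E u v + rdist E v w"
proof (rule rdist_le)
  show "(u, w) \<in> E ^^ (rdist E u v + rdist E v w)"
    unfolding relpow_add using rdist_relpow[OF assms(1)] rdist_relpow[OF assms(2)] by blast
qed

lemma rdist_eq_0D: "(u, v) \<in> E\<^sup>* \<Longrightarrow> rdist E u v = 0 \<Longrightarrow> u = v"
  using rdist_relpow[of u v E] by simp

text \<open>Acyclicity speaks of vertex lists because the cycles to be excluded are assembled from
  vertices met while climbing towards a root.\<close>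

locale finite_tree =
  fixes V :: "'a set" and E :: "'a rel"
  assumes finite_V: "finite V" and E_V: "E \<subseteq> V \<times> V" and sym_E: "sym E" and irrefl_E: "(v, v) \<notin> E"
    and conn: "\<lbrakk>u \<in> V; v \<in> V\<rbrakk> \<Longrightarrow> (u, v) \<in> E\<^sup>*"
    and acyc: "\<lbrakk>distinct xs; 3 \<le> length xs; successively (\<lambda>u v. (u, v) \<in> E) xs\<rbrakk> \<Longrightarrow> (last xs, hd xs) \<notin> E"
begin

abbreviation d where "d \<equiv> rdist E"

sublocale finite_metric V d
proof
  show "1 \<le> d x y" if "x \<in> V" "y \<in> V" "x \<noteq> y" for x y
    using rdist_eq_0D[OF conn[OF that(1,2)]] that(3) by fastforce
qed (auto simp: finite_V rdist_refl rdist_sym[OF sym_E] intro: rdist_triangle conn)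

lemma d_edge: "(u, v) \<in> E \<Longrightarrow> d u v = 1"
  using rdist_le[of u v 1 E] d_pos[of u v] E_V irrefl_E by (metis SigmaD1 SigmaD2 le_antisym relpow_1 subsetD)

lemma edge_iff: "\<lbrakk>u \<in> V; v \<in> V\<rbrakk> \<Longrightarrow> d u v = 1 \<longleftrightarrow> (u, v) \<in> E"
  using rdist_relpow[OF conn, of u v] d_edge by auto

lemma lipschitz_dist:
  fixes g :: "'a \<Rightarrow> int"
  assumes "\<And>u v. (u, v) \<in> E \<Longrightarrow> \<bar>g u - g v\<bar> \<le> 1" and "u \<in> V" "v \<in> V"
  shows "\<bar>g u - g v\<bar> \<le> int (d u v)"
proof -
  have "(u, v) \<in> E ^^ n \<Longrightarrow> \<bar>g u - g v\<bar> \<le> int n" for n v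
  proof (induction n arbitrary: v)
    case (Suc n)
    then obtain w where "(u, w) \<in> E ^^ n" "(w, v) \<in> E" by auto
    then show ?case using Suc.IH[of w] assms(1)[of w v] by simp
  qed simp
  then show ?thesis using rdist_relpow[OF conn[OF assms(2,3)]] by blast
qed

lemma walk_dist:
  assumes "\<And>i. Suc i < n \<Longrightarrow> (f i, f (Suc i)) \<in> E" "i \<le> j" "j < n"
  shows "d (f i) (f j) \<le> j - i"
proof (rule rdist_le)
  show "(f i, f j) \<in> E ^^ (j - i)"
    using assms(2,3)
  proof (induction j)
    case (Suc j)
    show ?case
    proof (cases "i = Suc j")
      case False
      then have "(f i, f j) \<in> E ^^ (j - i)" using Suc by auto
      then have "(f i, f (Suc j)) \<in> E ^^ Suc (j - i)" using assms(1)[of j] Suc.prems by auto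
      moreover have "Suc (j - i) = Suc j - i" using False Suc.prems by simp
      ultimately show ?thesis by simp
    qed simp
  qed simp
qed

text \<open>The function \<open>g\<close> is a potential: it changes by at most one along an edge
  and grows by one at each step of the walk, so no shortcut exists.\<close>

lemma isometric_walk:
  fixes g :: "'a \<Rightarrow> int"
  assumes walk: "\<And>i. Suc i < n \<Longrightarrow> (f i, f (Suc i)) \<in> E"
    and lip: "\<And>u v. (u, v) \<in> E \<Longrightarrow> \<bar>g u - g v\<bar> \<le> 1"
    and g: "\<And>i. i < n \<Longrightarrow> f i \<in> V \<and> g (f i) = int i + b"
  shows "isometric d f {0..<n}"
proof -
  have le: "d (f i) (f j) = j - i" if "i \<le> j" "j < n" for i j
  proof -
    have "\<bar>g (f i) - g (f j)\<bar> \<le> int (d (f i) (f j))"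
      using g that by (intro lipschitz_dist lip) auto
    then have "j - i \<le> d (f i) (f j)" using g that by auto
    then show ?thesis using walk_dist[of n f i j, OF walk that] by simp
  qed
  show ?thesis unfolding isometric_def
  proof (intro ballI)
    fix i j assume "i \<in> {0..<n}" "j \<in> {0..<n}"
    then show "d (f i) (f j) = i - j + (j - i)"
      using le[of i j] le[of j i] d_sym[of "f i" "f j"] by (cases "i \<le> j") auto
  qed
qed

lemma connected_in_V: "connected_in V"
proof -
  have "{(u, v). u \<in> V \<and> v \<in> V \<and> d u v = 1} = E" using edge_iff E_V by auto
  then show ?thesis unfolding connected_in_def using conn by simp
qed

lemma connected_in_path:
  assumes "isometric d f {i0..<n}"
  shows "connected_in (f ` {i0..<n})"
proof -
  let ?A = "f ` {i0..<n}"
  let ?R = "{(u, v). u \<in> ?A \<and> v \<in> ?A \<and> d u v = 1}"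
  have up: "(f i, f j) \<in> ?R\<^sup>*" if "i0 \<le> i" "i \<le> j" "j < n" for i j
    using that(2,3)
  proof (induction j)
    case 0
    then show ?case by simp
  next
    case (Suc j)
    show ?case
    proof (cases "i = Suc j")
      case False
      then have "(f i, f j) \<in> ?R\<^sup>*" using Suc by auto
      moreover have "(f j, f (Suc j)) \<in> ?R"
        using assms that(1) False Suc.prems unfolding isometric_def by auto
      ultimately show ?thesis by (rule rtrancl_into_rtrancl)
    qed simp
  qed
  have "sym ?R" by (auto intro!: symI simp: d_sym)
  then have "sym (?R\<^sup>*)" by (rule sym_rtrancl)
  show ?thesis unfolding connected_in_def
  proof (intro ballI)
    fix x y assume "x \<in> ?A" "y \<in> ?A"
    then obtain i j where "x = f i" "y = f j" "i \<in> {i0..<n}" "j \<in> {i0..<n}" by auto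
    then show "(x, y) \<in> ?R\<^sup>*"
      using up[of i j] up[of j i] symD[OF \<open>sym (?R\<^sup>*)\<close>] by (cases "i \<le> j") auto
  qed
qed

end

section \<open>Rooted trees and parents\<close>

locale rooted_tree = finite_tree V E for V :: "'a set" and E +
  fixes t :: 'a
  assumes t_V: "t \<in> V"
begin

abbreviation depth :: "'a \<Rightarrow> nat" where "depth v \<equiv> d v t"

definition Ch :: "'a rel" where
  "Ch = {(u, v). (u, v) \<in> E \<and> depth v = depth u + 1}"

lemma depth_0: "v \<in> V \<Longrightarrow> depth v = 0 \<Longrightarrow> v = t"
  using rdist_eq_0D[OF conn] t_V by blast

lemma depth_lip:
  assumes "(u, v) \<in> E"
  shows "depth u \<le> depth v + 1"
  using d_tri[of u v t] d_edge[OF assms] E_V t_V assms by fastforce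

lemma Ch_exists:
  assumes "v \<in> V" "v \<noteq> t"
  shows "\<exists>u. (u, v) \<in> Ch"
proof -
  obtain n where n: "depth v = Suc n" using depth_0[OF assms(1)] assms(2) by (cases "depth v") auto
  then have "(v, t) \<in> E ^^ Suc n" using rdist_relpow[OF conn[OF assms(1) t_V]] by simp
  then obtain u where u: "(v, u) \<in> E" "(u, t) \<in> E ^^ n" by (metis relpow_Suc_D2)
  have "(u, v) \<in> E" using u(1) sym_E by (auto dest: symD)
  moreover have "depth v = depth u + 1"
    using rdist_le[OF u(2)] depth_lip[OF u(1)] n by simp
  ultimately show ?thesis unfolding Ch_def by blast
qed

text \<open>Two vertices of the same depth are joined by a path that does not go below them, namely
  through their last common ancestor; every violation of the tree structure closes it to a cycle.\<close>

lemma path_through_ancestor: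
  assumes "u \<in> V" "v \<in> V" "u \<noteq> v" "depth u = n" "depth v = n"
  shows "\<exists>xs. xs \<noteq> [] \<and> hd xs = u \<and> last xs = v \<and> distinct xs \<and> 3 \<le> length xs \<and>
      successively (\<lambda>u v. (u, v) \<in> E) xs \<and> (\<forall>x\<in>set xs. depth x \<le> n)"
  using assms
proof (induction n arbitrary: u v)
  case 0
  then show ?case using depth_0 by metis
next
  case (Suc n)
  have "u \<noteq> t" "v \<noteq> t" using Suc.prems rdist_refl[of E t] by auto
  then obtain u' v' where uv: "(u', u) \<in> Ch" "(v', v) \<in> Ch" using Ch_exists Suc.prems by metis
  then have dep: "depth u' = n" "depth v' = n" using Suc.prems by (auto simp: Ch_def)
  have inV: "u' \<in> V" "v' \<in> V" using uv E_V by (auto simp: Ch_def)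
  have E: "(u, u') \<in> E" "(v', v) \<in> E" using uv sym_E by (auto simp: Ch_def dest: symD)
  show ?case
  proof (cases "u' = v'")
    case True
    have "u' \<noteq> u" "u' \<noteq> v" using dep Suc.prems by auto
    then show ?thesis
      using True E Suc.prems dep by (intro exI[of _ "[u, u', v]"]) auto
  next
    case False
    then obtain xs where xs: "xs \<noteq> []" "hd xs = u'" "last xs = v'" "distinct xs" "3 \<le> length xs"
        "successively (\<lambda>u v. (u, v) \<in> E) xs" "\<forall>x\<in>set xs. depth x \<le> n"
      using Suc.IH[OF inV False dep] by blast
    have "u \<notin> set xs" "v \<notin> set xs" using xs(7) Suc.prems by fastforce+
    then have "distinct (u # xs @ [v])" using xs(4) Suc.prems by simp
    moreover have "successively (\<lambda>u v. (u, v) \<in> E) (u # xs @ [v])"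
      using xs E by (simp add: successively_Cons successively_append_iff)
    moreover have "\<forall>x\<in>set (u # xs @ [v]). depth x \<le> Suc n" using xs(7) Suc.prems by auto
    ultimately show ?thesis using xs(5) by (intro exI[of _ "u # xs @ [v]"]) auto
  qed
qed

lemma edge_cases:
  assumes "(u, v) \<in> E"
  shows "(u, v) \<in> Ch \<or> (v, u) \<in> Ch"
proof -
  have vu: "(v, u) \<in> E" using assms sym_E by (auto dest: symD)
  have "depth u \<noteq> depth v"
  proof
    assume eq: "depth u = depth v"
    have "u \<in> V" "v \<in> V" "u \<noteq> v" using assms E_V irrefl_E by auto
    then obtain xs where xs: "hd xs = u" "last xs = v" "distinct xs" "3 \<le> length xs"
        "successively (\<lambda>u v. (u, v) \<in> E) xs"
      using path_through_ancestor[of u v "depth v"] eq by blast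
    then show False using acyc[OF xs(3,4,5)] vu by simp
  qed
  then show ?thesis using depth_lip[OF assms] depth_lip[OF vu] assms vu by (auto simp: Ch_def)
qed

lemma Ch_unique:
  assumes "(u, w) \<in> Ch" "(v, w) \<in> Ch"
  shows "u = v"
proof (rule ccontr)
  assume "u \<noteq> v"
  have dep: "depth u = depth v" "depth w = depth v + 1" using assms by (auto simp: Ch_def)
  have "u \<in> V" "v \<in> V" using assms E_V by (auto simp: Ch_def)
  then obtain xs where xs: "xs \<noteq> []" "hd xs = u" "last xs = v" "distinct xs" "3 \<le> length xs"
      "successively (\<lambda>u v. (u, v) \<in> E) xs" "\<forall>x\<in>set xs. depth x \<le> depth v"
    using path_through_ancestor[of u v "depth v"] \<open>u \<noteq> v\<close> dep by blast
  have "(w, u) \<in> E" "(v, w) \<in> E" using assms sym_E by (auto simp: Ch_def dest: symD)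
  moreover have "w \<notin> set xs" using xs(7) dep by auto
  ultimately show False
    using acyc[of "w # xs"] xs by (simp add: successively_Cons)
qed

lemma Ch_E: "(u, v) \<in> Ch \<Longrightarrow> (u, v) \<in> E"
  by (simp add: Ch_def)

lemma Ch_V: "(u, v) \<in> Ch \<Longrightarrow> u \<in> V \<and> v \<in> V"
  using E_V by (auto simp: Ch_def)

lemma Ch_depth: "(u, v) \<in> Ch \<Longrightarrow> depth v = depth u + 1"
  by (simp add: Ch_def)

section \<open>Preferred children and the chains they generate\<close>

definition childless :: "'a \<Rightarrow> bool" where
  "childless v \<longleftrightarrow> (\<forall>w. (v, w) \<notin> Ch)"

definition ht :: "'a \<Rightarrow> nat" where
  "ht v = (LEAST n. \<exists>w. childless w \<and> (v, w) \<in> Ch ^^ n)"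

lemma childless_below:
  assumes "v \<in> V"
  shows "\<exists>n w. childless w \<and> (v, w) \<in> Ch ^^ n"
proof -
  have bound: "depth u \<le> Max (depth ` V)" if "u \<in> V" for u using that finite_V by simp
  show ?thesis using assms
  proof (induction "Max (depth ` V) - depth v" arbitrary: v rule: less_induct)
    case less
    show ?case
    proof (cases "childless v")
      case True
      then show ?thesis by (intro exI[of _ 0]) auto
    next
      case False
      then obtain c where c: "(v, c) \<in> Ch" by (auto simp: childless_def)
      then have "Max (depth ` V) - depth c < Max (depth ` V) - depth v"
        using bound[of c] Ch_depth[OF c] Ch_V[OF c] by auto
      then obtain n w where "childless w" "(c, w) \<in> Ch ^^ n" using less Ch_V[OF c] by blast
      then have "childless w \<and> (v, w) \<in> Ch ^^ Suc n" using c by (meson relpow_Suc_I2)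
      then show ?thesis by blast
    qed
  qed
qed

lemma ht_witness:
  assumes "v \<in> V"
  shows "\<exists>w. childless w \<and> (v, w) \<in> Ch ^^ ht v"
  unfolding ht_def by (rule LeastI_ex[OF childless_below[OF assms]])

lemma ht_le: "childless w \<Longrightarrow> (v, w) \<in> Ch ^^ n \<Longrightarrow> ht v \<le> n"
  unfolding ht_def by (rule Least_le) blast

lemma ht_Ch_le:
  assumes "(v, c) \<in> Ch"
  shows "ht v \<le> ht c + 1"
proof -
  obtain w where "childless w" "(c, w) \<in> Ch ^^ ht c" using ht_witness Ch_V[OF assms] by blast
  moreover from this have "(v, w) \<in> Ch ^^ Suc (ht c)" using assms by (intro relpow_Suc_I2)
  ultimately show ?thesis using ht_le[of w v "Suc (ht c)"] by simp
qed

lemma ht_0: "v \<in> V \<Longrightarrow> ht v = 0 \<longleftrightarrow> childless v"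
  using ht_witness[of v] ht_le[of v v 0] by auto

lemma shortest_child:
  assumes "v \<in> V" "ht v \<noteq> 0"
  shows "\<exists>c. (v, c) \<in> Ch \<and> ht v = ht c + 1"
proof -
  obtain n where n: "ht v = Suc n" using assms(2) by (cases "ht v") auto
  obtain w where w: "childless w" "(v, w) \<in> Ch ^^ Suc n" using ht_witness[OF assms(1)] n by auto
  then obtain c where c: "(v, c) \<in> Ch" "(c, w) \<in> Ch ^^ n" by (metis relpow_Suc_D2)
  have "ht c \<le> n" using ht_le[OF w(1) c(2)] .
  then show ?thesis using c(1) ht_Ch_le[OF c(1)] n by (intro exI[of _ c]) auto
qed

definition pc :: "'a \<Rightarrow> 'a" where
  "pc v = (SOME c. (v, c) \<in> Ch \<and> ht v = ht c + 1)"

lemma pc: "v \<in> V \<Longrightarrow> ht v \<noteq> 0 \<Longrightarrow> (v, pc v) \<in> Ch \<and> ht v = ht (pc v) + 1"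
  unfolding pc_def by (rule someI_ex[OF shortest_child])

abbreviation chain :: "'a \<Rightarrow> nat \<Rightarrow> 'a" where "chain v i \<equiv> (pc ^^ i) v"

lemma chain:
  assumes "v \<in> V" "i \<le> ht v"
  shows "chain v i \<in> V" "ht (chain v i) + i = ht v" "depth (chain v i) = depth v + i"
proof -
  have "chain v i \<in> V \<and> ht (chain v i) + i = ht v \<and> depth (chain v i) = depth v + i"
    using assms(2)
  proof (induction i)
    case (Suc i)
    then have IH: "chain v i \<in> V" "ht (chain v i) + i = ht v" "depth (chain v i) = depth v + i" by auto
    then have "ht (chain v i) \<noteq> 0" using Suc.prems by auto
    from pc[OF IH(1) this] have "(chain v i, chain v (Suc i)) \<in> Ch" "ht (chain v i) = ht (chain v (Suc i)) + 1"
      by auto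
    then show ?case using IH Ch_V Ch_depth by fastforce
  qed (use assms in auto)
  then show "chain v i \<in> V" "ht (chain v i) + i = ht v" "depth (chain v i) = depth v + i" by auto
qed

lemma chain_Ch:
  assumes "v \<in> V" "i < ht v"
  shows "(chain v i, chain v (Suc i)) \<in> Ch"
proof -
  have "chain v i \<in> V" "ht (chain v i) \<noteq> 0" using chain[of v i] assms by auto
  then show ?thesis using pc by simp
qed

lemma chain_end_childless: "v \<in> V \<Longrightarrow> childless (chain v (ht v))"
  using chain[of v "ht v"] ht_0 by auto

lemma depth_lip_int: "(u, v) \<in> E \<Longrightarrow> \<bar>int (depth u) - int (depth v)\<bar> \<le> 1"
  using depth_lip[of u v] depth_lip[of v u] sym_E by (force dest: symD)

lemma isometric_chain:
  assumes "v \<in> V"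
  shows "isometric d (chain v) {0..<ht v + 1}"
proof (rule isometric_walk[where g = "\<lambda>v. int (depth v)" and b = "int (depth v)"])
  show "(chain v i, chain v (Suc i)) \<in> E" if "Suc i < ht v + 1" for i
    using chain_Ch[OF assms] that Ch_E by simp
  show "chain v i \<in> V \<and> int (depth (chain v i)) = int i + int (depth v)" if "i < ht v + 1" for i
    using chain[OF assms, of i] that by auto
qed (rule depth_lip_int)

text \<open>The tops of the descending paths: the vertices that their parent does not prefer,
  including the root.\<close>

definition heads :: "'a set" where
  "heads = {c \<in> V. \<forall>v. (v, c) \<in> Ch \<longrightarrow> pc v \<noteq> c}"

lemma t_head: "t \<in> heads"
  using Ch_depth[of _ t] rdist_refl[of E t] t_V by (auto simp: heads_def)

lemma chain_up:
  assumes "v \<in> V" "w \<in> V" "i \<le> ht v" "j \<le> ht w" "chain v i = chain w j" "i \<le> j"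
  shows "v = chain w (j - i)"
  using assms
proof (induction i arbitrary: j)
  case (Suc i)
  then obtain j' where j: "j = Suc j'" by (cases j) auto
  have "(chain v i, chain v (Suc i)) \<in> Ch" "(chain w j', chain w (Suc j')) \<in> Ch"
    using Suc.prems(3,4) j by (auto intro!: chain_Ch Suc.prems(1,2) simp del: funpow.simps)
  then have "chain v i = chain w j'" using Ch_unique Suc.prems(5) j by metis
  then show ?case using Suc.IH[of j'] Suc.prems j by auto
qed simp

text \<open>Parents are unique, so two chains that meet coincide upwards until the top of one lies
  on the other; a head can only lie there as its top.\<close>

lemma heads_disjoint:
  assumes "v \<in> heads" "w \<in> heads" "i \<le> ht v" "j \<le> ht w" "chain v i = chain w j"
  shows "v = w"
proof -
  have *: "v = w" if vw: "v \<in> heads" "w \<in> heads" "i \<le> ht v" "j \<le> ht w" "chain v i = chain w j" "i \<le> j" for v w i j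
  proof -
    have V: "v \<in> V" "w \<in> V" using vw by (auto simp: heads_def)
    have v: "v = chain w (j - i)" by (rule chain_up[OF V vw(3-6)])
    show ?thesis
    proof (cases "j - i")
      case (Suc m)
      then have "(chain w m, v) \<in> Ch" "pc (chain w m) = v"
        using chain_Ch[OF V(2), of m] vw v by auto
      then show ?thesis using vw(1) by (auto simp: heads_def)
    qed (use v in simp)
  qed
  show ?thesis
    using *[OF assms] *[OF assms(2,1,4,3) assms(5)[symmetric]] by (cases "i \<le> j") auto
qed

lemma heads_cover:
  assumes "v \<in> V"
  shows "\<exists>c\<in>heads. \<exists>i\<le>ht c. v = chain c i"
  using assms
proof (induction "depth v" arbitrary: v)
  case 0
  then show ?case using depth_0[of v] t_head by (intro bexI[of _ t] exI[of _ 0]) auto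
next
  case (Suc n)
  then have "v \<noteq> t" using rdist_refl[of E t] by auto
  then obtain u where u: "(u, v) \<in> Ch" using Ch_exists Suc.prems by blast
  show ?case
  proof (cases "pc u = v")
    case True
    obtain c i where c: "c \<in> heads" "i \<le> ht c" "u = chain c i"
      using Suc.hyps(1)[of u] Suc.hyps(2) Ch_depth[OF u] Ch_V[OF u] by auto
    have "ht u \<noteq> 0" using u ht_0 Ch_V[OF u] by (auto simp: childless_def)
    moreover have "ht u + i = ht c" using chain(2)[of c i] c by (auto simp: heads_def)
    ultimately have "Suc i \<le> ht c" "v = chain c (Suc i)" using True c(3) by auto
    then show ?thesis using c(1) by blast
  next
    case False
    then have "v \<in> heads" using u Ch_unique Suc.prems unfolding heads_def by blast
    then show ?thesis by (intro bexI[of _ v] exI[of _ 0]) auto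
  qed
qed

definition tleaf :: "'a \<Rightarrow> bool" where
  "tleaf v \<longleftrightarrow> v \<in> V \<and> card {w. (v, w) \<in> E} = 1"

lemma childless_leaf:
  assumes "v \<in> V" "childless v" "v \<noteq> t"
  shows "tleaf v"
proof -
  obtain u where u: "(u, v) \<in> Ch" using Ch_exists assms by blast
  have "{w. (v, w) \<in> E} = {u}"
  proof
    show "{w. (v, w) \<in> E} \<subseteq> {u}"
      using edge_cases[of v] Ch_unique[OF _ u] assms(2) by (auto simp: childless_def)
    show "{u} \<subseteq> {w. (v, w) \<in> E}" using u sym_E by (auto simp: Ch_def dest: symD)
  qed
  then show ?thesis using assms by (simp add: tleaf_def)
qed

lemma root_not_childless:
  assumes "V \<noteq> {t}"
  shows "ht t \<noteq> 0"
proof -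
  obtain v where v: "v \<in> V" "v \<noteq> t" using assms t_V by blast
  then have "(t, v) \<in> E\<^sup>*" using conn t_V by blast
  then obtain w where "(t, w) \<in> E" using v(2) by (metis converse_rtranclE)
  then have "(t, w) \<in> Ch" using edge_cases[of t w] Ch_depth[of w t] rdist_refl[of E t] by auto
  then show ?thesis using ht_0[OF t_V] by (auto simp: childless_def)
qed

lemma leaf_exists:
  assumes "V \<noteq> {t}"
  shows "\<exists>w. tleaf w \<and> w \<noteq> t"
proof -
  let ?w = "chain t (ht t)"
  have w: "?w \<in> V" "depth ?w = ht t" using chain[OF t_V, of "ht t"] rdist_refl[of E t] by auto
  then have "?w \<noteq> t" using root_not_childless[OF assms] rdist_refl[of E t] by metis
  then show ?thesis using childless_leaf w chain_end_childless t_V by blast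
qed

end

section \<open>Consequences of the spread\<close>

locale spread_tree = rooted_tree V E t for V :: "'a set" and E t +
  fixes k h :: nat
  assumes spread: "\<lbrakk>tleaf u; tleaf v; u \<noteq> v\<rbrakk> \<Longrightarrow> k \<le> d u v"
    and kh: "k \<le> 2 * h" "2 * h \<le> k + 1" and k: "2 \<le> k" and nontrivial: "V \<noteq> {t}"
begin

text \<open>The nearest leaves below two siblings are joined by a path through the parent with
  \<open>ht c + ht c' + 2\<close> edges.\<close>

lemma siblings_ht:
  assumes "(v, c) \<in> Ch" "(v, c') \<in> Ch" "c \<noteq> c'"
  shows "k \<le> ht c + ht c' + 2"
proof -
  have V: "c \<in> V" "c' \<in> V" "v \<in> V" using assms Ch_V by blast+
  let ?w = "chain c (ht c)" and ?w' = "chain c' (ht c')"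
  have dc: "depth c = depth v + 1" "depth c' = depth v + 1" using assms Ch_depth by blast+
  have W: "?w \<in> V" "?w' \<in> V" "depth ?w = depth c + ht c" "depth ?w' = depth c' + ht c'"
    using chain V by blast+
  have ne: "?w \<noteq> ?w'"
  proof
    assume eq: "?w = ?w'"
    then have "ht c = ht c'" using W dc by simp
    then have "c = chain c' (ht c' - ht c)" using chain_up[OF V(1,2) _ _ eq] by simp
    then show False using \<open>ht c = ht c'\<close> assms(3) by simp
  qed
  have "?w \<noteq> t" "?w' \<noteq> t" using W dc rdist_refl[of E t] by auto
  then have "tleaf ?w" "tleaf ?w'"
    using childless_leaf W chain_end_childless V by blast+
  then have "k \<le> d ?w ?w'" using spread ne by blast
  also have "\<dots> \<le> d ?w c + d c ?w'" using d_tri W V by blast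
  also have "\<dots> \<le> d ?w c + (d c v + d v ?w')" using d_tri[of c v ?w'] W V by simp
  also have "\<dots> \<le> d ?w c + (d c v + (d v c' + d c' ?w'))" using d_tri[of v c' ?w'] W V by simp
  also have "d ?w c = ht c" using isometric_chain[OF V(1)] d_sym[of ?w c]
    unfolding isometric_def by force
  also have "d c' ?w' = ht c'" using isometric_chain[OF V(2)] unfolding isometric_def by force
  also have "d c v = 1" using d_edge assms(1) d_sym[of c v] Ch_E by simp
  also have "d v c' = 1" using d_edge assms(2) Ch_E by simp
  finally show ?thesis by simp
qed

text \<open>A head other than the root has a preferred sibling that is at least as close to a leaf,
  so it bears at least half of the bound on siblings.\<close>

lemma head_ht:
  assumes "c \<in> heads" "c \<noteq> t"
  shows "h \<le> ht c + 1"
proof -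
  have cV: "c \<in> V" using assms by (simp add: heads_def)
  then obtain v where v: "(v, c) \<in> Ch" using Ch_exists assms(2) by blast
  then have vV: "v \<in> V" using Ch_V by blast
  have "ht v \<noteq> 0" using v ht_0[OF vV] by (auto simp: childless_def)
  then have p: "(v, pc v) \<in> Ch" "ht v = ht (pc v) + 1" using pc vV by auto
  have "pc v \<noteq> c" using assms v by (auto simp: heads_def)
  then have "k \<le> ht c + ht (pc v) + 2" using siblings_ht[OF v p(1)] by auto
  moreover have "ht (pc v) \<le> ht c" using ht_Ch_le[OF v] p(2) by simp
  ultimately show ?thesis using kh by linarith
qed

lemma t_not_childless: "ht t \<noteq> 0"
  by (rule root_not_childless[OF nontrivial])

text \<open>Otherwise the root is itself a leaf, and a second leaf lies at distance
  \<open>ht t < h\<close>, less than the spread.\<close>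

lemma second_child:
  assumes "ht t < h"
  shows "\<exists>c. (t, c) \<in> Ch \<and> c \<noteq> pc t"
proof (rule ccontr)
  assume no: "\<not> ?thesis"
  have p: "(t, pc t) \<in> Ch" using pc[OF t_V t_not_childless] by blast
  have "{w. (t, w) \<in> E} = {pc t}"
  proof
    show "{w. (t, w) \<in> E} \<subseteq> {pc t}"
      using edge_cases[of t] Ch_depth[of _ t] rdist_refl[of E t] no by fastforce
    show "{pc t} \<subseteq> {w. (t, w) \<in> E}" using p Ch_E by blast
  qed
  then have "tleaf t" using t_V by (simp add: tleaf_def)
  let ?w = "chain t (ht t)"
  have w: "?w \<in> V" "depth ?w = ht t" using chain[OF t_V, of "ht t"] rdist_refl[of E t] by auto
  then have "?w \<noteq> t" using t_not_childless rdist_refl[of E t] by metis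
  then have "tleaf ?w" using childless_leaf w chain_end_childless t_V by blast
  then have "k \<le> d ?w t" using spread \<open>tleaf t\<close> \<open>?w \<noteq> t\<close> by blast
  then show False using w assms kh k by linarith
qed

lemma Ch_rtrancl_unique:
  assumes "(u, w) \<in> Ch\<^sup>*" "(v, w) \<in> Ch\<^sup>*" "depth u = depth v"
  shows "u = v"
proof -
  have mono: "depth x \<le> depth y" if "(x, y) \<in> Ch\<^sup>*" for x y
    using that by (induction rule: rtrancl_induct) (auto simp: Ch_def)
  show ?thesis using assms(1,2,3)
  proof (induction arbitrary: v rule: rtrancl_induct)
    case base
    from base(1) show ?case
    proof (cases rule: rtranclE)
      case (step y)
      then have "depth v \<le> depth y" "depth u = depth y + 1" using mono Ch_depth by blast+
      then show ?thesis using base(2) by linarith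
    qed simp
  next
    case (step y z)
    note yz = step.hyps and IH = step.IH and vz = step.prems(1) and eq = step.prems(2)
    have ne: "v \<noteq> z" using mono[OF yz(1)] Ch_depth[OF yz(2)] eq by auto
    obtain y' where y': "(v, y') \<in> Ch\<^sup>*" "(y', z) \<in> Ch" using vz ne by (metis rtranclE)
    then have "y' = y" using Ch_unique yz(2) by blast
    then show ?case using IH[OF _ eq] y'(1) by blast
  qed
qed

text \<open>The vertices \<open>f 0, \<dots>, f (l - 1)\<close> form the short branch at \<open>t = f l\<close>, if there is one.\<close>

lemma path_decomposition:
  obtains f l L J where
    "f l = t" "isometric d f {0..<l + L}" "f ` {0..<l + L} \<subseteq> V"
    "h < L" "l < h" "l = 0 \<or> k < l + L" "J \<subseteq> V" "t \<notin> J"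
    "\<And>c. c \<in> J \<Longrightarrow> h \<le> ht c + 1"
    "\<And>c c'. \<lbrakk>c \<in> J; c' \<in> J; c \<noteq> c'\<rbrakk> \<Longrightarrow> chain c ` {0..<ht c + 1} \<inter> chain c' ` {0..<ht c' + 1} = {}"
    "V = f ` {0..<l + L} \<union> (\<Union>c\<in>J. chain c ` {0..<ht c + 1})"
    "f ` {0..<l + L} \<inter> (\<Union>c\<in>J. chain c ` {0..<ht c + 1}) = {}"
proof -
  let ?I = "\<lambda>c. chain c ` {0..<ht c + 1}"
  have disj: "?I c \<inter> ?I c' = {}" if "c \<in> heads" "c' \<in> heads" "c \<noteq> c'" for c c'
    using heads_disjoint[OF that(1,2)] that(3) by fastforce
  have cover: "V = (\<Union>c\<in>heads. ?I c)"
  proof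
    show "V \<subseteq> (\<Union>c\<in>heads. ?I c)" using heads_cover by fastforce
    show "(\<Union>c\<in>heads. ?I c) \<subseteq> V" using chain(1) by (fastforce simp: heads_def)
  qed
  show ?thesis
  proof (cases "h \<le> ht t")
    case True
    show ?thesis
    proof (rule that[where f = "chain t" and l = 0 and L = "ht t + 1" and J = "heads - {t}"])
      show "isometric d (chain t) {0..<0 + (ht t + 1)}" using isometric_chain[OF t_V] by simp
      show "V = chain t ` {0..<0 + (ht t + 1)} \<union> (\<Union>c\<in>heads - {t}. ?I c)"
        using cover t_head by auto
      show "chain t ` {0..<0 + (ht t + 1)} \<inter> (\<Union>c\<in>heads - {t}. ?I c) = {}"
        using disj t_head by fastforce
      show "chain t ` {0..<0 + (ht t + 1)} \<subseteq> V" using cover t_head by auto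
      show "0 < h" using kh k by linarith
    qed (use True head_ht disj heads_def in auto)
  next
    case False
    define l where "l = ht t"
    obtain c where c: "(t, c) \<in> Ch" "c \<noteq> pc t" using second_child False by auto
    have cV: "c \<in> V" using c Ch_V by blast
    have chd: "c \<in> heads" using c cV Ch_unique unfolding heads_def by blast
    have ct: "c \<noteq> t" using Ch_depth[OF c(1)] by auto
    define L where "L = ht c + 2"
    \<comment> \<open>The short preferred chain of the root is traversed backwards up to
      \<open>t\<close> and continued by the chain of another child.\<close>
    define f where "f = (\<lambda>i. if i \<le> l then chain t (l - i) else chain c (i - l - 1))"
    have ptc: "(t, pc t) \<in> Ch" using pc[OF t_V t_not_childless] by blast
    define A where "A = {v. (pc t, v) \<in> Ch\<^sup>*}"
    \<comment> \<open>Signed depth, negative below the preferred child of the root. It increases by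
      one along \<open>f\<close>, which makes \<open>f\<close> isometric although it bends at
      \<open>t\<close>.\<close>
    define g where "g = (\<lambda>v. if v \<in> A then - int (depth v) else int (depth v))"
    have gl: "\<bar>g u - g v\<bar> \<le> 1" if uv: "(u, v) \<in> Ch" for u v
    proof (cases "u \<in> A")
      case True
      then have "v \<in> A" using uv unfolding A_def by (auto intro: rtrancl_into_rtrancl)
      then show ?thesis using True Ch_depth[OF uv] by (simp add: g_def)
    next
      case uA: False
      show ?thesis
      proof (cases "v \<in> A")
        case True
        then have "(pc t, v) \<in> Ch\<^sup>*" by (simp add: A_def)
        then have "v = pc t"
        proof (cases rule: rtranclE)
          case (step y)
          then have "y = u" using uv Ch_unique by blast
          then show ?thesis using step uA by (simp add: A_def)
        qed simp
        then have "u = t" using uv ptc Ch_unique by blast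
        then show ?thesis using uA True Ch_depth[OF uv] rdist_refl[of E t] by (simp add: g_def)
      next
        case False
        then show ?thesis using uA Ch_depth[OF uv] by (simp add: g_def)
      qed
    qed
    have lip: "\<bar>g u - g v\<bar> \<le> 1" if "(u, v) \<in> E" for u v
      using edge_cases[OF that] gl[of u v] gl[of v u] by auto
    have chain_star: "(chain v i, chain v (i + j)) \<in> Ch\<^sup>*" if "v \<in> V" "i + j \<le> ht v" for v i j
      using that(2)
    proof (induction j)
      case (Suc j)
      then show ?case using chain_Ch[OF that(1), of "i + j"] by (auto intro: rtrancl_into_rtrancl)
    qed simp
    have g1: "g (chain t i) = - int i" if "i \<le> ht t" for i
    proof (cases i)
      case 0
      have "t \<notin> A"
      proof
        assume "t \<in> A"
        then have "(pc t, t) \<in> Ch\<^sup>*" by (simp add: A_def)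
        then show False
          by (cases rule: rtranclE) (use Ch_depth[OF ptc] Ch_depth[of _ t] rdist_refl[of E t] in auto)
      qed
      then show ?thesis using 0 rdist_refl[of E t] by (simp add: g_def)
    next
      case (Suc j)
      then have "chain t i \<in> A" using chain_star[OF t_V, of 1 j] that by (simp add: A_def)
      then show ?thesis using chain(3)[OF t_V that] rdist_refl[of E t] by (simp add: g_def)
    qed
    have g2: "g (chain c i) = int i + 1" if "i \<le> ht c" for i
    proof -
      have "(c, chain c i) \<in> Ch\<^sup>*" using chain_star[OF cV, of 0 i] that by simp
      then have "chain c i \<notin> A"
        using Ch_rtrancl_unique[of c "chain c i" "pc t"] c(2) Ch_depth[OF c(1)] Ch_depth[OF ptc]
        by (auto simp: A_def)
      then show ?thesis
        using chain(3)[OF cV that] Ch_depth[OF c(1)] rdist_refl[of E t] by (simp add: g_def)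
    qed
    have fV: "f i \<in> V \<and> g (f i) = int i + (- int l)" if "i < l + L" for i
    proof (cases "i \<le> l")
      case True
      then show ?thesis using chain(1)[OF t_V, of "l - i"] g1[of "l - i"] by (simp add: f_def l_def)
    next
      case False
      then show ?thesis
        using chain(1)[OF cV, of "i - l - 1"] g2[of "i - l - 1"] that by (simp add: f_def L_def)
    qed
    have fE: "(f i, f (Suc i)) \<in> E" if "Suc i < l + L" for i
    proof -
      consider "Suc i \<le> l" | "i = l" | "l < i" by linarith
      then show ?thesis
      proof cases
        case 1
        then have "(chain t (l - Suc i), chain t (Suc (l - Suc i))) \<in> E"
          using chain_Ch[OF t_V, of "l - Suc i"] Ch_E by (simp add: l_def)
        moreover have "Suc (l - Suc i) = l - i" using 1 by simp
        moreover have "f (Suc i) = chain t (l - Suc i)" "f i = chain t (l - i)"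
          using 1 by (simp_all add: f_def)
        ultimately have "(f (Suc i), f i) \<in> E" by metis
        then show ?thesis using sym_E by (auto dest: symD)
      next
        case 2
        then show ?thesis using c(1) Ch_E by (simp add: f_def)
      next
        case 3
        then have "(chain c (i - l - 1), chain c (Suc (i - l - 1))) \<in> E"
          using chain_Ch[OF cV, of "i - l - 1"] that Ch_E by (simp add: L_def)
        moreover have "f i = chain c (i - l - 1)" "f (Suc i) = chain c (i - l)"
          using 3 by (simp_all add: f_def)
        moreover have "i - l = Suc (i - l - 1)" using 3 by simp
        ultimately show ?thesis by metis
      qed
    qed
    have iso: "isometric d f {0..<l + L}"
      by (rule isometric_walk[OF fE lip fV])
    have img: "f ` {0..<l + L} = ?I t \<union> ?I c"
    proof
      show "f ` {0..<l + L} \<subseteq> ?I t \<union> ?I c"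
      proof
        fix x assume "x \<in> f ` {0..<l + L}"
        then obtain i where i: "i < l + L" "x = f i" by auto
        then show "x \<in> ?I t \<union> ?I c"
          by (cases "i \<le> l") (auto simp: f_def l_def L_def intro!: imageI)
      qed
      show "?I t \<union> ?I c \<subseteq> f ` {0..<l + L}"
      proof
        fix x assume "x \<in> ?I t \<union> ?I c"
        then consider i where "i \<le> l" "x = chain t i" | i where "i \<le> ht c" "x = chain c i"
          by (auto simp: l_def less_Suc_eq_le)
        then show "x \<in> f ` {0..<l + L}"
        proof cases
          case (1 i)
          then have "x = f (l - i)" "l - i < l + L" by (auto simp: f_def L_def)
          then show ?thesis by auto
        next
          case (2 i)
          then have "x = f (l + 1 + i)" "l + 1 + i < l + L" by (auto simp: f_def L_def)
          then show ?thesis by auto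
        qed
      qed
    qed
    have htl: "ht t = ht (pc t) + 1" using pc[OF t_V t_not_childless] by blast
    show ?thesis
    proof (rule that[OF _ iso, where J = "heads - {t, c}"])
      show "f l = t" by (simp add: f_def)
      show "f ` {0..<l + L} \<subseteq> V" using fV by auto
      show "h < L" using head_ht[OF chd ct] by (simp add: L_def)
      show "l < h" using False by (simp add: l_def)
      \<comment> \<open>The siblings \<open>c\<close> and \<open>pc t\<close> yield
        \<open>k \<le> ht c + ht (pc t) + 2\<close>; the number of vertices exceeds this sum by one
        because \<open>t\<close> is counted too.\<close>
      show "l = 0 \<or> k < l + L" using siblings_ht[OF c(1) ptc c(2)] htl by (simp add: l_def L_def)
      show "V = f ` {0..<l + L} \<union> (\<Union>c\<in>heads - {t, c}. ?I c)"
      proof -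
        have eq: "heads = insert t (insert c (heads - {t, c}))" using t_head chd by blast
        have "(\<Union>x\<in>heads. ?I x) = (\<Union>x\<in>insert t (insert c (heads - {t, c})). ?I x)"
          by (rule arg_cong[where f = "\<lambda>S. \<Union>x\<in>S. ?I x", OF eq])
        also have "\<dots> = ?I t \<union> (?I c \<union> (\<Union>x\<in>heads - {t, c}. ?I x))"
          by (simp only: UN_insert)
        finally show ?thesis unfolding img using cover by (simp only: Un_assoc)
      qed
      show "f ` {0..<l + L} \<inter> (\<Union>c\<in>heads - {t, c}. ?I c) = {}"
      proof -
        have "(?I t \<union> ?I c) \<inter> ?I x = {}" if "x \<in> heads - {t, c}" for x
        proof -
          have "x \<in> heads" "t \<noteq> x" "c \<noteq> x" using that by auto
          then show ?thesis
            using disj[OF t_head, of x] disj[OF chd, of x] by (simp only: Int_Un_distrib2 Un_empty simp_thms)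
        qed
        then show ?thesis unfolding img by (simp only: Int_UN_distrib) simp
      qed
    qed (use head_ht disj heads_def in auto)
  qed
qed

end

section \<open>The cube of a tree\<close>

context finite_tree
begin

definition d3 :: "'a \<times> 'a \<times> 'a \<Rightarrow> 'a \<times> 'a \<times> 'a \<Rightarrow> nat" where
  "d3 u v = d (fst u) (fst v) + d2 (snd u) (snd v)"

text \<open>\<open>pl x w\<close> puts \<open>x\<close> into one of the three coordinates and the
  cell \<open>w\<close> into the other two, so that each bundle argument serves all three
  directions.\<close>

definition places :: "('a \<Rightarrow> 'a \<times> 'a \<Rightarrow> 'a \<times> 'a \<times> 'a) \<Rightarrow> bool" where
  "places pl \<longleftrightarrow> (\<forall>x w x' w'. d3 (pl x w) (pl x' w') = d x x' + d2 w w')"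

lemma places_coordinates:
  "places (\<lambda>x w. (x, w))" "places (\<lambda>y w. (fst w, y, snd w))" "places (\<lambda>z w. (fst w, snd w, z))"
  by (auto simp: places_def d3_def d2_def)

definition descending :: "'a \<Rightarrow> nat \<Rightarrow> (nat \<Rightarrow> 'a) \<Rightarrow> nat \<Rightarrow> bool" where
  "descending u e f n \<longleftrightarrow> isometric d f {0..<n} \<and> (\<forall>i<n. f i \<in> V \<and> d (f i) u = e + i)"

lemma grid_bundle_places:
  assumes "places pl" "descending u e f a" and AB: "A \<subseteq> V" "B \<subseteq> V" "connected_in A" "connected_in B"
    and V: "u \<in> V" "s \<in> V" "s' \<in> V" and D: "\<And>x y. x \<in> V \<Longrightarrow> y \<in> V \<Longrightarrow> d x y \<le> D"
  shows "grid_bundle V d d3 (pl u (s, s')) (\<lambda>i. pl (f i)) a e A B s s' (3 * D)"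
proof
  have pl: "d3 (pl x w) (pl x' w') = d x x' + d2 w w'" for x w x' w'
    using assms(1) unfolding places_def by blast
  show "d3 (pl (f i) w) (pl (f j) w') = i - j + (j - i) + d2 w w'"
    if "w \<in> A \<times> B" "w' \<in> A \<times> B" "i < a" "j < a" for w w' i j
    using assms(2) that by (simp add: pl descending_def isometric_def)
  show "d3 (pl (f i) w) (pl u (s, s')) = e + i + d2 w (s, s')" if "w \<in> A \<times> B" "i < a" for w i
    using assms(2) that by (simp add: pl descending_def)
  show "e + i + d2 w (s, s') \<le> 3 * D" if "w \<in> A \<times> B" "i < a" for w i
  proof -
    have "e + i \<le> D" using assms(2) that D[of "f i" u] V by (simp add: descending_def)
    moreover have "d (fst w) s \<le> D" "d (snd w) s' \<le> D" using D that AB V by auto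
    ultimately show ?thesis by (simp add: d2_def)
  qed
qed (use assms in auto)

text \<open>The paths \<open>p\<close> and \<open>p'\<close> inside the cell sets make room for the
  reserved rectangle; in the application they are initial parts of legs.\<close>

lemma clearable_descending_far:
  assumes "places pl" "descending u e f a" and "A \<subseteq> V" "B \<subseteq> V" "connected_in A" "connected_in B"
    and "u \<in> V" "s \<in> V" "s' \<in> V" "\<And>x y. x \<in> V \<Longrightarrow> y \<in> V \<Longrightarrow> d x y \<le> D"
    and h: "36 \<le> h" "h \<le> a" "18 * D \<le> h * h" "1 \<le> e"
    and p: "descending s 0 p (h + 1)" "p ` {0..h} \<subseteq> A"
    and p': "descending s' 0 p' (h + 1)" "p' ` {0..h} \<subseteq> B"
  shows "clearable d3 (pl u (s, s')) (\<Union>i\<in>{0..<a}. pl (f i) ` (A \<times> B))"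
proof -
  interpret grid_bundle V d d3 "pl u (s, s')" "\<lambda>i. pl (f i)" a e A B s s' "3 * D"
    by (rule grid_bundle_places) (use assms in auto)
  have "clearable d3 (pl u (s, s')) (lines (A \<times> B))"
  proof (rule clearable_long_lines[OF h(1) _ _ h(4)])
    show "p i \<in> A \<and> d (p i) s = i" "p' i \<in> B \<and> d (p' i) s' = i" if "i \<le> h" for i
      using p p' that by (auto simp: descending_def)
    show "isometric d p {0..h}" "isometric d p' {0..h}"
      using p(1) p'(1) by (auto simp: descending_def intro: isometric_subset)
  qed (use h in auto)
  moreover have "lines (A \<times> B) = (\<Union>i\<in>{0..<a}. pl (f i) ` (A \<times> B))"
    by (auto simp: lines_def line_def)
  ultimately show ?thesis by simp
qed

text \<open>The lines start at the coordinate of the target, so a cell near the target has demand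
  one. No long path in \<open>A\<close> or \<open>B\<close> is needed, which admits stubs.\<close>

lemma clearable_descending_near:
  assumes "places pl" "descending u 0 f a" and "A \<subseteq> V" "B \<subseteq> V" "connected_in A" "connected_in B"
    and "u \<in> V" "s \<in> V" "s' \<in> V" "\<And>x y. x \<in> V \<Longrightarrow> y \<in> V \<Longrightarrow> d x y \<le> D"
    and h: "36 \<le> h" "h \<le> a" "18 * D \<le> h * h"
    and r: "y0 \<in> A" "z0 \<in> B" "y0 \<notin> S" "B - S' \<noteq> {}" "d2 (y0, z0) (s, s') \<le> h"
    and pos: "\<And>w. w \<in> A \<times> B - S \<times> S' \<Longrightarrow> w \<noteq> (s, s')"
  shows "clearable d3 (pl u (s, s')) (\<Union>i\<in>{0..<a}. pl (f i) ` (A \<times> B - S \<times> S'))"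
proof -
  interpret grid_bundle V d d3 "pl u (s, s')" "\<lambda>i. pl (f i)" a 0 A B s s' "3 * D"
    by (rule grid_bundle_places) (use assms in auto)
  have "clearable d3 (pl u (s, s')) (lines (A \<times> B - S \<times> S'))"
  proof (rule clearable_near_target[OF r(1-4)])
    have "h * h \<le> a * a" using h by (intro mult_le_mono)
    then show "3 * (3 * D) \<le> a * a" using h by linarith
    show "1 \<le> 0 + d2 w (s, s')" if w: "w \<in> A \<times> B - S \<times> S'" for w
    proof -
      have "fst w \<in> V" "snd w \<in> V" using w assms by auto
      moreover have "fst w \<noteq> s \<or> snd w \<noteq> s'" using pos[OF w] by (cases w) auto
      ultimately show ?thesis
        using d_pos[of "fst w" s] d_pos[of "snd w" s'] assms by (auto simp: d2_def)
    qed
  qed (use h r in auto)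
  moreover have "lines (A \<times> B - S \<times> S') = (\<Union>i\<in>{0..<a}. pl (f i) ` (A \<times> B - S \<times> S'))"
    by (auto simp: lines_def line_def)
  ultimately show ?thesis by simp
qed

end

text \<open>Conclusion of the path decomposition of a tree with root \<open>t\<close>: a path through \<open>t\<close> consisting of
  a branch of length \<open>l\<close> and a leg with \<open>L\<close> vertices that starts at \<open>t = f l\<close>, and long paths that
  descend away from \<open>t\<close>.\<close>

locale tree_paths = finite_tree V E for V :: "'a set" and E +
  fixes k h :: nat and t :: 'a and f :: "nat \<Rightarrow> 'a" and l L :: nat
    and J :: "'a set" and g :: "'a \<Rightarrow> nat \<Rightarrow> 'a" and n e :: "'a \<Rightarrow> nat"
  assumes f_l: "f l = t" and iso_f: "isometric d f {0..<l + L}" and f_V: "f ` {0..<l + L} \<subseteq> V"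
    and hL: "h < L" "l < h" "l = 0 \<or> k < l + L" and kh: "2 * h \<le> k + 1"
    and J: "finite J" "\<And>c. c \<in> J \<Longrightarrow> h \<le> n c \<and> 1 \<le> e c \<and> descending t (e c) (g c) (n c)"
    and J_disj: "\<And>c c'. \<lbrakk>c \<in> J; c' \<in> J; c \<noteq> c'\<rbrakk> \<Longrightarrow> g c ` {0..<n c} \<inter> g c' ` {0..<n c'} = {}"
    and cover: "V = f ` {0..<l + L} \<union> (\<Union>c\<in>J. g c ` {0..<n c})"
    and f_disj: "f ` {0..<l + L} \<inter> (\<Union>c\<in>J. g c ` {0..<n c}) = {}"
begin

definition spine :: "'a set" where "spine = f ` {0..<l + L}"
definition stub :: "'a set" where "stub = f ` {0..<l}"
definition leg :: "'a set" where "leg = f ` {l..<l + L}"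
definition rest :: "'a set" where "rest = (\<Union>c\<in>J. g c ` {0..<n c})"

lemma t_V: "t \<in> V" using f_V f_l hL(1) by force

lemma leg_descending: "descending t 0 (\<lambda>i. f (l + i)) L"
  using iso_f f_V f_l by (auto simp: descending_def isometric_def)

lemma leg_alt: "leg = (\<lambda>i. f (l + i)) ` {0..<L}"
  using image_image[of f "(+) l" "{0..<L}"] by (simp add: leg_def add.commute)

lemma sets: "V = spine \<union> rest" "spine \<inter> rest = {}" "spine = stub \<union> leg" "stub \<inter> leg = {}"
  "spine \<subseteq> V" "t \<in> leg"
proof -
  show "V = spine \<union> rest" "spine \<inter> rest = {}" "spine \<subseteq> V"
    using cover f_disj f_V unfolding spine_def rest_def by simp_all
  have "{0..<l + L} = {0..<l} \<union> {l..<l + L}" by auto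
  then show "spine = stub \<union> leg" unfolding spine_def stub_def leg_def by (metis image_Un)
  show "stub \<inter> leg = {}"
    using inj_onD[OF isometric_inj_on[OF iso_f]] unfolding stub_def leg_def by fastforce
  show "t \<in> leg" using f_l hL(1) unfolding leg_def by force
qed

lemma connected_sets: "connected_in V" "connected_in spine" "connected_in stub"
  unfolding spine_def stub_def
  using connected_in_V connected_in_path iso_f isometric_subset[OF iso_f, of "{0..<l}"] by auto

lemma leg_start:
  "descending t 0 (\<lambda>i. f (l + i)) (h + 1)" "(\<lambda>i. f (l + i)) ` {0..h} \<subseteq> spine" "(\<lambda>i. f (l + i)) ` {0..h} \<subseteq> V"
  using leg_descending hL(1) f_V by (auto simp: descending_def spine_def intro: isometric_subset)

lemma leg_second: "f (l + 1) \<in> spine" "f (l + 1) \<noteq> t" "d (f (l + 1)) t = 1"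
proof -
  have "1 < L" using hL(1,2) by linarith
  then show "d (f (l + 1)) t = 1" using leg_descending unfolding descending_def by (metis add_0)
  then show "f (l + 1) \<noteq> t" using rdist_refl[of E t] by auto
  show "f (l + 1) \<in> spine" using hL(1,2) by (auto simp: spine_def)
qed

lemma leg_minus_root: "leg - {t} = (\<lambda>i. f (l + i)) ` {1..<L}"
proof -
  have "{0..<L} = insert 0 {1..<L}" using hL(1) by auto
  then have "leg = insert t ((\<lambda>i. f (l + i)) ` {1..<L})"
    unfolding leg_alt using f_l by (metis (no_types, lifting) add_0_right image_insert)
  moreover have "t \<notin> (\<lambda>i. f (l + i)) ` {1..<L}"
    using leg_descending rdist_refl[of E t] by (force simp: descending_def)
  ultimately show ?thesis by simp
qed

lemma stub_empty: "l = 0 \<Longrightarrow> stub = {}"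
  unfolding stub_def by simp

lemma leg_eq_spine: "l = 0 \<Longrightarrow> leg = spine"
  unfolding leg_def spine_def by simp

lemma t_rest: "t \<notin> rest"
  using sets(2,3,6) by blast

lemma stub_V: "stub \<subseteq> V"
  using sets by blast

lemma stub_dist: "x \<in> stub \<Longrightarrow> 1 \<le> d x t \<and> d x t \<le> l \<and> x \<in> V"
  using iso_f f_l f_V hL unfolding stub_def isometric_def by fastforce

lemma stub_first: "1 \<le> l \<Longrightarrow> f (l - 1) \<in> stub \<and> d (f (l - 1)) t = 1"
  using iso_f f_l hL unfolding stub_def isometric_def by fastforce

end

lemma times_Diff_Un:
  assumes "V = S \<union> R"
  shows "x \<notin> A \<times> B \<times> R \<Longrightarrow> (A \<times> B \<times> S - {x}) \<union> A \<times> B \<times> R = A \<times> B \<times> V - {x}"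
    and "x \<notin> A \<times> R \<times> B \<Longrightarrow> (A \<times> S \<times> B - {x}) \<union> A \<times> R \<times> B = A \<times> V \<times> B - {x}"
    and "x \<notin> R \<times> A \<times> B \<Longrightarrow> (S \<times> A \<times> B - {x}) \<union> R \<times> A \<times> B = V \<times> A \<times> B - {x}"
  unfolding assms by auto

text \<open>The long paths off the spines are treated one coordinate after another, so that the cell
  sets still contain the legs in both other coordinates. The product of the spines is then divided
  into boxes, each with a leg or a whole spine as its line.\<close>

lemma cube_clearable:
  assumes 1: "tree_paths V E k h t1 f1 l1 L1 J1 g1 n1 e1"
    and 2: "tree_paths V E k h t2 f2 l2 L2 J2 g2 n2 e2"
    and 3: "tree_paths V E k h t3 f3 l3 L3 J3 g3 n3 e3"
    and D: "\<And>x y. x \<in> V \<Longrightarrow> y \<in> V \<Longrightarrow> rdist E x y \<le> D" and h: "36 \<le> h" "18 * D \<le> h * h"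
  shows "clearable (finite_tree.d3 E) (t1, t2, t3) (V \<times> V \<times> V - {(t1, t2, t3)})"
proof -
  interpret a: tree_paths V E k h t1 f1 l1 L1 J1 g1 n1 e1 by (rule 1)
  interpret b: tree_paths V E k h t2 f2 l2 L2 J2 g2 n2 e2 by (rule 2)
  interpret c: tree_paths V E k h t3 f3 l3 L3 J3 g3 n3 e3 by (rule 3)
  let ?cl = "clearable a.d3 (t1, t2, t3)"
  note pl = a.places_coordinates
  have F1: "?cl (a.rest \<times> V \<times> V)"
  proof -
    have "?cl (\<Union>x\<in>J1. g1 x ` {0..<n1 x} \<times> V \<times> V)"
    proof (rule clearable_UN[OF a.J(1)])
      fix x assume x: "x \<in> J1"
      have "?cl (\<Union>i\<in>{0..<n1 x}. (\<lambda>w. (g1 x i, w)) ` (V \<times> V))"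
        using a.clearable_descending_far[OF pl(1), of t1 "e1 x" "g1 x" "n1 x" V V t2 t3 D h
            "\<lambda>i. f2 (l2 + i)" "\<lambda>i. f3 (l3 + i)"]
          a.J(2)[OF x] a.t_V b.t_V c.t_V a.connected_sets b.leg_start c.leg_start D h by simp
      moreover have "(\<Union>i\<in>{0..<n1 x}. (\<lambda>w. (g1 x i, w)) ` (V \<times> V)) = g1 x ` {0..<n1 x} \<times> V \<times> V"
        by auto
      ultimately show "?cl (g1 x ` {0..<n1 x} \<times> V \<times> V)" by simp
    qed (use a.J_disj in fast)
    moreover have "(\<Union>x\<in>J1. g1 x ` {0..<n1 x} \<times> V \<times> V) = a.rest \<times> V \<times> V"
      by (auto simp: a.rest_def)
    ultimately show ?thesis by simp
  qed
  have F2: "?cl (a.spine \<times> b.rest \<times> V)"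
  proof -
    have "?cl (\<Union>x\<in>J2. a.spine \<times> g2 x ` {0..<n2 x} \<times> V)"
    proof (rule clearable_UN[OF b.J(1)])
      fix x assume x: "x \<in> J2"
      have "?cl (\<Union>i\<in>{0..<n2 x}. (\<lambda>w. (fst w, g2 x i, snd w)) ` (a.spine \<times> V))"
        using a.clearable_descending_far[OF pl(2), of t2 "e2 x" "g2 x" "n2 x" a.spine V t1 t3 D h
            "\<lambda>i. f1 (l1 + i)" "\<lambda>i. f3 (l3 + i)"]
          b.J(2)[OF x] a.t_V b.t_V c.t_V a.connected_sets a.sets(5) a.leg_start c.leg_start D h by simp
      moreover have "(\<Union>i\<in>{0..<n2 x}. (\<lambda>w. (fst w, g2 x i, snd w)) ` (a.spine \<times> V)) = a.spine \<times> g2 x ` {0..<n2 x} \<times> V"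
        by force
      ultimately show "?cl (a.spine \<times> g2 x ` {0..<n2 x} \<times> V)" by simp
    qed (use b.J_disj in fast)
    moreover have "(\<Union>x\<in>J2. a.spine \<times> g2 x ` {0..<n2 x} \<times> V) = a.spine \<times> b.rest \<times> V"
      by (auto simp: b.rest_def)
    ultimately show ?thesis by simp
  qed
  have F3: "?cl (a.spine \<times> b.spine \<times> c.rest)"
  proof -
    have "?cl (\<Union>x\<in>J3. a.spine \<times> b.spine \<times> g3 x ` {0..<n3 x})"
    proof (rule clearable_UN[OF c.J(1)])
      fix x assume x: "x \<in> J3"
      have "?cl (\<Union>i\<in>{0..<n3 x}. (\<lambda>w. (fst w, snd w, g3 x i)) ` (a.spine \<times> b.spine))"
        using a.clearable_descending_far[OF pl(3), of t3 "e3 x" "g3 x" "n3 x" a.spine b.spine t1 t2 D h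
            "\<lambda>i. f1 (l1 + i)" "\<lambda>i. f2 (l2 + i)"]
          c.J(2)[OF x] a.t_V b.t_V c.t_V a.connected_sets b.connected_sets a.sets(5) b.sets(5)
          a.leg_start b.leg_start D h by simp
      moreover have "(\<Union>i\<in>{0..<n3 x}. (\<lambda>w. (fst w, snd w, g3 x i)) ` (a.spine \<times> b.spine)) = a.spine \<times> b.spine \<times> g3 x ` {0..<n3 x}"
        by force
      ultimately show "?cl (a.spine \<times> b.spine \<times> g3 x ` {0..<n3 x})" by simp
    qed (use c.J_disj in fast)
    moreover have "(\<Union>x\<in>J3. a.spine \<times> b.spine \<times> g3 x ` {0..<n3 x}) = a.spine \<times> b.spine \<times> c.rest"
      by (auto simp: c.rest_def)
    ultimately show ?thesis by simp
  qed
  \<comment> \<open>The line through the target itself is left out: it contains the target and its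
    cell has demand 0.\<close>
  have F4: "?cl (a.leg \<times> (b.spine \<times> c.spine - {t2} \<times> {t3}))"
  proof -
    have "?cl (\<Union>i\<in>{0..<L1}. (\<lambda>w. (f1 (l1 + i), w)) ` (b.spine \<times> c.spine - {t2} \<times> {t3}))"
    proof (rule a.clearable_descending_near[OF pl(1) a.leg_descending])
      show "f2 (l2 + 1) \<in> b.spine" "f2 (l2 + 1) \<notin> {t2}" "t3 \<in> c.spine"
        using b.leg_second c.sets by auto
      show "c.spine - {t3} \<noteq> {}" using c.leg_second by auto
      show "a.d2 (f2 (l2 + 1), t3) (t2, t3) \<le> h"
        using b.leg_second(3) h by (simp add: a.d2_def rdist_refl)
    qed (use a.t_V b.t_V c.t_V b.sets(5) c.sets(5) b.connected_sets c.connected_sets D h a.hL in auto)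
    moreover have "(\<Union>i\<in>{0..<L1}. (\<lambda>w. (f1 (l1 + i), w)) ` (b.spine \<times> c.spine - {t2} \<times> {t3})) =
        a.leg \<times> (b.spine \<times> c.spine - {t2} \<times> {t3})"
      unfolding a.leg_alt by auto
    ultimately show ?thesis by simp
  qed
  \<comment> \<open>The omitted line without the target has \<open>L1 - 1\<close> vertices, and its
    far end is at distance \<open>L1 - 1\<close>.\<close>
  have F4': "?cl ((a.leg - {t1}) \<times> {t2} \<times> {t3})"
  proof -
    have "?cl ((\<lambda>i. (f1 (l1 + i), t2, t3)) ` {1..<L1})"
    proof (rule clearable_path[where m = "L1 - 1"])
      show "isometric a.d3 (\<lambda>i. (f1 (l1 + i), t2, t3)) {1..<L1}"
        using a.leg_descending
        by (auto simp: isometric_def a.descending_def a.d3_def a.d2_def rdist_refl)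
      show "a.d3 (f1 (l1 + (L1 - 1)), t2, t3) (t1, t2, t3) = L1 - 1"
      proof -
        have "L1 - 1 < L1" using a.hL(1) by simp
        then have "a.d (f1 (l1 + (L1 - 1))) t1 = L1 - 1"
          using a.leg_descending unfolding a.descending_def by fastforce
        then show ?thesis by (simp add: a.d3_def a.d2_def rdist_refl)
      qed
    qed (use a.hL h in auto)
    moreover have "(\<lambda>i. (f1 (l1 + i), t2, t3)) ` {1..<L1} = (a.leg - {t1}) \<times> {t2} \<times> {t3}"
      unfolding a.leg_minus_root by blast
    ultimately show ?thesis by simp
  qed
  \<comment> \<open>No cell has to be excluded, since a stub does not contain the root.\<close>
  have F5: "?cl (a.stub \<times> b.leg \<times> c.spine)"
  proof (cases "l1 = 0")
    case True
    show ?thesis unfolding a.stub_empty[OF True] by (simp add: clearable.empty)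
  next
    case False
    have "clearable a.d3 (fst (t1, t3), t2, snd (t1, t3))
        (\<Union>i\<in>{0..<L2}. (\<lambda>w. (fst w, f2 (l2 + i), snd w)) ` (a.stub \<times> c.spine - {} \<times> {}))"
    proof (rule a.clearable_descending_near[OF pl(2) b.leg_descending, where s = t1 and s' = t3])
      show "f1 (l1 - 1) \<in> a.stub" "t3 \<in> c.spine" using a.stub_first False c.sets by auto
      show "a.d2 (f1 (l1 - 1), t3) (t1, t3) \<le> h"
        using a.stub_first False h by (simp add: a.d2_def rdist_refl)
      show "w \<noteq> (t1, t3)" if "w \<in> a.stub \<times> c.spine - {} \<times> {}" for w
        using that a.stub_dist[of t1] rdist_refl[of E t1] by auto
      show "c.spine - {} \<noteq> {}" using c.sets by auto
    qed (use a.t_V b.t_V c.t_V a.stub_V c.sets(5) a.connected_sets c.connected_sets D h b.hL in auto)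
    moreover have "(\<Union>i\<in>{0..<L2}. (\<lambda>w. (fst w, f2 (l2 + i), snd w)) ` (a.stub \<times> c.spine - {} \<times> {})) =
        a.stub \<times> b.leg \<times> c.spine"
      unfolding b.leg_alt by force
    ultimately show ?thesis by simp
  qed
  have F6: "?cl (a.stub \<times> b.stub \<times> c.spine)"
  proof -
    consider "l1 = 0 \<or> l2 = 0" | "l1 \<noteq> 0" "l2 \<noteq> 0" "l3 = 0" | "l3 \<noteq> 0" by blast
    then show ?thesis
    proof cases
      case 1
      then have "a.stub \<times> b.stub = {}" using a.stub_empty b.stub_empty by blast
      then have "a.stub \<times> b.stub \<times> c.spine = {}" by blast
      then show ?thesis by (simp only: clearable.empty)
    next
      case 2
      have "clearable a.d3 (fst (t1, t2), snd (t1, t2), t3)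
          (\<Union>i\<in>{0..<L3}. (\<lambda>w. (fst w, snd w, f3 (l3 + i))) ` (a.stub \<times> b.stub - {} \<times> {}))"
      proof (rule a.clearable_descending_near[OF pl(3) c.leg_descending, where s = t1 and s' = t2])
        show "f1 (l1 - 1) \<in> a.stub" "f2 (l2 - 1) \<in> b.stub" using a.stub_first b.stub_first 2 by auto
        show "a.d2 (f1 (l1 - 1), f2 (l2 - 1)) (t1, t2) \<le> h"
          using a.stub_first b.stub_first 2 h by (simp add: a.d2_def)
        show "w \<noteq> (t1, t2)" if "w \<in> a.stub \<times> b.stub - {} \<times> {}" for w
          using that a.stub_dist[of t1] rdist_refl[of E t1] by auto
        show "b.stub - {} \<noteq> {}" using b.stub_first 2 by auto
      qed (use a.t_V b.t_V c.t_V a.stub_V b.stub_V a.connected_sets b.connected_sets D h c.hL in auto)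
      moreover have "(\<Union>i\<in>{0..<L3}. (\<lambda>w. (fst w, snd w, f3 (l3 + i))) ` (a.stub \<times> b.stub - {} \<times> {})) =
          a.stub \<times> b.stub \<times> c.leg"
        unfolding c.leg_alt by force
      moreover have "c.leg = c.spine" using 2(3) by (rule c.leg_eq_spine)
      ultimately show ?thesis by simp
    next
      \<comment> \<open>The third stub may be very short, so each line over the whole spine is
        cleared on its own. At the bend its distance from the target is at most
        \<open>l1 + l2 \<le> 2 * h - 2\<close>, less than \<open>k\<close> and so than
        \<open>l3 + L3\<close>. For \<open>l3 = 0\<close> only \<open>h < L3\<close> is known, hence
        the previous case.\<close>
      case 3
      have line: "?cl ((\<lambda>i. (x, y, f3 i)) ` {0..<l3 + L3})" if xy: "x \<in> a.stub" "y \<in> b.stub" for x y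
      proof (rule clearable_bent_path[where r = "a.d x t1 + a.d y t2"])
        have "k < l3 + L3" using 3 c.hL by blast
        then show "l3 + 2 \<le> L3" "a.d x t1 + a.d y t2 \<le> l3 + L3" "1 \<le> a.d x t1 + a.d y t2"
          using c.kh a.hL b.hL c.hL a.stub_dist[OF xy(1)] b.stub_dist[OF xy(2)] by linarith+
        show "isometric a.d3 (\<lambda>i. (x, y, f3 i)) {0..<l3 + L3}"
          using c.iso_f by (auto simp: isometric_def a.d3_def a.d2_def rdist_refl)
        show "a.d3 (x, y, f3 i) (t1, t2, t3) = a.d x t1 + a.d y t2 + (i - l3 + (l3 - i))"
          if "i < l3 + L3" for i
          using c.iso_f that c.f_l c.hL by (auto simp: isometric_def a.d3_def a.d2_def)
      qed
      have "?cl (\<Union>w\<in>a.stub \<times> b.stub. (\<lambda>i. (fst w, snd w, f3 i)) ` {0..<l3 + L3})"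
        by (rule clearable_UN) (use line in \<open>auto simp: a.stub_def b.stub_def\<close>)
      moreover have "(\<Union>w\<in>a.stub \<times> b.stub. (\<lambda>i. (fst w, snd w, f3 i)) ` {0..<l3 + L3}) = a.stub \<times> b.stub \<times> c.spine"
        by (force simp: c.spine_def)
      ultimately show ?thesis by simp
    qed
  qed
  have "?cl (a.leg \<times> (b.spine \<times> c.spine - {t2} \<times> {t3}) \<union> (a.leg - {t1}) \<times> {t2} \<times> {t3})"
    by (rule clearable_Un[OF F4 F4']) auto
  moreover have "a.leg \<times> (b.spine \<times> c.spine - {t2} \<times> {t3}) \<union> (a.leg - {t1}) \<times> {t2} \<times> {t3} =
      a.leg \<times> b.spine \<times> c.spine - {(t1, t2, t3)}"
    using b.sets(3,6) c.sets(3,6) by auto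
  ultimately have leg1: "?cl (a.leg \<times> b.spine \<times> c.spine - {(t1, t2, t3)})" by simp
  have "?cl (a.stub \<times> b.leg \<times> c.spine \<union> a.stub \<times> b.stub \<times> c.spine)"
    by (rule clearable_Un[OF F5 F6]) (use b.sets(4) in auto)
  moreover have "a.stub \<times> b.leg \<times> c.spine \<union> a.stub \<times> b.stub \<times> c.spine = a.stub \<times> b.spine \<times> c.spine"
    using b.sets(3) by auto
  ultimately have stub1: "?cl (a.stub \<times> b.spine \<times> c.spine)" by simp
  have "?cl ((a.leg \<times> b.spine \<times> c.spine - {(t1, t2, t3)}) \<union> a.stub \<times> b.spine \<times> c.spine)"
    by (rule clearable_Un[OF leg1 stub1]) (use a.sets(4) in auto)
  moreover have "(a.leg \<times> b.spine \<times> c.spine - {(t1, t2, t3)}) \<union> a.stub \<times> b.spine \<times> c.spine =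
      a.spine \<times> b.spine \<times> c.spine - {(t1, t2, t3)}"
    using a.sets(3,4,6) by auto
  ultimately have spines: "?cl (a.spine \<times> b.spine \<times> c.spine - {(t1, t2, t3)})" by simp
  have "?cl ((a.spine \<times> b.spine \<times> c.spine - {(t1, t2, t3)}) \<union> a.spine \<times> b.spine \<times> c.rest)"
    by (rule clearable_Un[OF spines F3]) (use c.sets(2) in auto)
  moreover have "(a.spine \<times> b.spine \<times> c.spine - {(t1, t2, t3)}) \<union> a.spine \<times> b.spine \<times> c.rest =
      a.spine \<times> b.spine \<times> V - {(t1, t2, t3)}"
    by (rule times_Diff_Un(1)[OF c.sets(1)]) (simp add: c.t_rest)
  ultimately have "?cl (a.spine \<times> b.spine \<times> V - {(t1, t2, t3)})" by simp
  then have "?cl ((a.spine \<times> b.spine \<times> V - {(t1, t2, t3)}) \<union> a.spine \<times> b.rest \<times> V)"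
    by (rule clearable_Un[OF _ F2]) (use b.sets(2) in auto)
  moreover have "(a.spine \<times> b.spine \<times> V - {(t1, t2, t3)}) \<union> a.spine \<times> b.rest \<times> V =
      a.spine \<times> V \<times> V - {(t1, t2, t3)}"
    by (rule times_Diff_Un(2)[OF b.sets(1)]) (simp add: b.t_rest)
  ultimately have "?cl (a.spine \<times> V \<times> V - {(t1, t2, t3)})" by simp
  then have "?cl ((a.spine \<times> V \<times> V - {(t1, t2, t3)}) \<union> a.rest \<times> V \<times> V)"
    by (rule clearable_Un[OF _ F1]) (use a.sets(2) in auto)
  moreover have "(a.spine \<times> V \<times> V - {(t1, t2, t3)}) \<union> a.rest \<times> V \<times> V = V \<times> V \<times> V - {(t1, t2, t3)}"
    by (rule times_Diff_Un(3)[OF a.sets(1)]) (simp add: a.t_rest)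
  ultimately show ?thesis by simp
qed

lemma (in spread_tree) tree_paths_exist: "\<exists>f l L J g n e. tree_paths V E k h t f l L J g n e"
proof (rule path_decomposition)
  fix f l L J
  assume A: "f l = t" "isometric d f {0..<l + L}" "f ` {0..<l + L} \<subseteq> V"
    "h < L" "l < h" "l = 0 \<or> k < l + L" "J \<subseteq> V" "t \<notin> J"
    "\<And>c. c \<in> J \<Longrightarrow> h \<le> ht c + 1"
    "\<And>c c'. \<lbrakk>c \<in> J; c' \<in> J; c \<noteq> c'\<rbrakk> \<Longrightarrow> chain c ` {0..<ht c + 1} \<inter> chain c' ` {0..<ht c' + 1} = {}"
    "V = f ` {0..<l + L} \<union> (\<Union>c\<in>J. chain c ` {0..<ht c + 1})"
    "f ` {0..<l + L} \<inter> (\<Union>c\<in>J. chain c ` {0..<ht c + 1}) = {}"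
  have "tree_paths V E k h t f l L J chain (\<lambda>c. ht c + 1) depth"
  proof
    fix c assume c: "c \<in> J"
    then have cV: "c \<in> V" using A(7) by blast
    have "descending t (depth c) (chain c) (ht c + 1)"
      unfolding descending_def using isometric_chain[OF cV] chain[OF cV] by (simp add: less_Suc_eq_le)
    moreover have "1 \<le> depth c" using d_pos[OF cV t_V] c A(8) by metis
    ultimately show "h \<le> ht c + 1 \<and> 1 \<le> depth c \<and> descending t (depth c) (chain c) (ht c + 1)"
      using A(9)[OF c] by blast
  qed (use A kh finite_V in \<open>auto intro: finite_subset\<close>)
  then show ?thesis by blast
qed

section \<open>Graphs and cup moves\<close>

lemma relpow_iff_arc_list:
  "(u, v) \<in> parcs G ^^ n \<longleftrightarrow>
    (\<exists>p. set p \<subseteq> parcs G \<and> pre_digraph.cas (with_proj G) u p v \<and> length p = n)"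
proof (induction n arbitrary: u)
  case 0
  then show ?case by (auto simp: pre_digraph.cas.simps)
next
  case (Suc n)
  show ?case
  proof
    assume "(u, v) \<in> parcs G ^^ Suc n"
    then obtain w where w: "(u, w) \<in> parcs G" "(w, v) \<in> parcs G ^^ n" by (metis relpow_Suc_D2)
    then obtain p where "set p \<subseteq> parcs G" "pre_digraph.cas (with_proj G) w p v" "length p = n"
      using Suc.IH by blast
    then show "\<exists>p. set p \<subseteq> parcs G \<and> pre_digraph.cas (with_proj G) u p v \<and> length p = Suc n"
      using w(1) by (intro exI[of _ "(u, w) # p"]) (auto simp: pre_digraph.cas.simps)
  next
    assume "\<exists>p. set p \<subseteq> parcs G \<and> pre_digraph.cas (with_proj G) u p v \<and> length p = Suc n"
    then obtain e p where p: "set (e # p) \<subseteq> parcs G" "pre_digraph.cas (with_proj G) u (e # p) v" "length p = n"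
      by (metis length_Suc_conv)
    then have "(snd e, v) \<in> parcs G ^^ n" using Suc.IH by (auto simp: pre_digraph.cas.simps)
    moreover have "(u, snd e) \<in> parcs G" using p by (auto simp: pre_digraph.cas.simps)
    ultimately show "(u, v) \<in> parcs G ^^ Suc n" by (meson relpow_Suc_I2)
  qed
qed

lemma graph_dist_eq_rdist: "u \<in> pverts G \<Longrightarrow> graph_dist G u v = rdist (parcs G) u v"
  unfolding graph_dist_def rdist_def relpow_iff_arc_list pre_digraph.awalk_def by (simp add: conj_assoc)

text \<open>The final vertex \<open>v\<close> is kept general for the induction; the application
  takes \<open>v = hd xs\<close>, which closes the walk to a cycle.\<close>

lemma closed_walk_of_vertices:
  assumes "xs \<noteq> []" "successively (\<lambda>u v. (u, v) \<in> parcs G) (xs @ [v])"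
  shows "\<exists>p. set p \<subseteq> parcs G \<and> pre_digraph.cas (with_proj G) (hd xs) p v \<and>
    pre_digraph.awalk_verts (with_proj G) (hd xs) p = xs @ [v] \<and> length p = length xs"
  using assms
proof (induction xs)
  case (Cons x xs)
  show ?case
  proof (cases xs)
    case Nil
    then show ?thesis
      using Cons.prems
      by (intro exI[of _ "[(x, v)]"]) (auto simp: pre_digraph.cas.simps pre_digraph.awalk_verts.simps)
  next
    case (Cons y ys)
    then obtain p where "set p \<subseteq> parcs G" "pre_digraph.cas (with_proj G) y p v"
      "pre_digraph.awalk_verts (with_proj G) y p = xs @ [v]" "length p = length xs"
      using Cons.IH Cons.prems by (auto simp: successively_Cons)
    then show ?thesis
      using Cons Cons.prems
      by (intro exI[of _ "(x, y) # p"])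
        (auto simp: pre_digraph.cas.simps pre_digraph.awalk_verts.simps successively_Cons)
  qed
qed simp

lemma finite_tree_of_is_tree:
  assumes "is_tree T"
  shows "finite_tree (pverts T) (parcs T)"
proof -
  interpret pair_graph T using assms by (simp add: is_tree_def)
  have arcs: "parcs T \<subseteq> pverts T \<times> pverts T"
    using in_arcsD1 in_arcsD2 by (metis SigmaI subrelI)
  have "symmetric (with_proj T)" by (rule sym_arcs)
  then have sym: "sym (parcs T)" by (simp add: symmetric_def)
  have sc: "strongly_connected (with_proj T)"
    using symmetric_connected_imp_strongly_connected sym_arcs assms by (simp add: is_tree_def)
  show ?thesis
  proof
    show "(v, v) \<notin> parcs T" for v using no_loops by fastforce
    show "(u, v) \<in> (parcs T)\<^sup>*" if "u \<in> pverts T" "v \<in> pverts T" for u v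
    proof -
      have "u \<rightarrow>\<^sup>*\<^bsub>with_proj T\<^esub> v" using sc that by (simp add: strongly_connected_def)
      then have "(u, v) \<in> rtrancl_on (pverts T) (parcs T)" by (simp add: reachable_def)
      then show ?thesis using rtrancl_on_sub_rtrancl by (rule rev_subsetD)
    qed
    show "(last xs, hd xs) \<notin> parcs T"
      if xs: "distinct xs" "3 \<le> length xs" "successively (\<lambda>u v. (u, v) \<in> parcs T) xs" for xs
    proof
      assume "(last xs, hd xs) \<in> parcs T"
      then have walk: "successively (\<lambda>u v. (u, v) \<in> parcs T) (xs @ [hd xs])"
        using xs by (auto simp: successively_append_iff)
      have ne: "xs \<noteq> []" using xs(2) by auto
      obtain p where p: "set p \<subseteq> parcs T" "pre_digraph.cas (with_proj T) (hd xs) p (hd xs)"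
        "pre_digraph.awalk_verts (with_proj T) (hd xs) p = xs @ [hd xs]" "length p = length xs"
        using closed_walk_of_vertices[OF ne walk] by blast
      have "hd xs \<in> pverts T" using \<open>(last xs, hd xs) \<in> parcs T\<close> arcs by blast
      moreover have "distinct (tl (xs @ [hd xs]))" using xs(1) ne by (cases xs) auto
      ultimately have "pre_digraph.cycle (with_proj T) p"
        unfolding pre_digraph.cycle_def pre_digraph.awalk_def using p xs(2)
        by (intro exI[of _ "hd xs"]) auto
      then show False using assms p(4) xs(2) by (auto simp: is_tree_def)
    qed
  qed (use arcs sym finite_verts in auto)
qed

lemma leaf_iff: "leaf T v \<longleftrightarrow> v \<in> pverts T \<and> card {w. (v, w) \<in> parcs T} = 1"
proof -
  have "out_arcs (with_proj T) v = Pair v ` {w. (v, w) \<in> parcs T}"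
    by (auto simp: out_arcs_def)
  then have "out_degree (with_proj T) v = card {w. (v, w) \<in> parcs T}"
    by (simp add: out_degree_def card_image inj_on_def)
  then show ?thesis by (simp add: leaf_def)
qed

text \<open>Each step moves exactly one coordinate, so a walk splits into its two projections with
  the lengths adding up.\<close>

lemma relpow_cart_prodD:
  "((x, y), (x', y')) \<in> parcs (G \<box> H) ^^ n \<Longrightarrow>
    \<exists>i j. i + j = n \<and> (x, x') \<in> parcs G ^^ i \<and> (y, y') \<in> parcs H ^^ j"
proof (induction n arbitrary: x' y')
  case 0
  then show ?case by auto
next
  case (Suc n)
  then obtain u v where uv: "((x, y), (u, v)) \<in> parcs (G \<box> H) ^^ n" "((u, v), (x', y')) \<in> parcs (G \<box> H)"
    by auto
  then obtain i j where ij: "i + j = n" "(x, u) \<in> parcs G ^^ i" "(y, v) \<in> parcs H ^^ j"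
    using Suc.IH by blast
  from uv(2) consider "u = x'" "(v, y') \<in> parcs H" | "(u, x') \<in> parcs G" "v = y'"
    by (auto simp: cart_prod_def)
  then show ?case
  proof cases
    case 1
    then show ?thesis using ij by (intro exI[of _ i] exI[of _ "Suc j"]) auto
  next
    case 2
    then show ?thesis using ij by (intro exI[of _ "Suc i"] exI[of _ j]) auto
  qed
qed

lemma relpow_cart_prodI1:
  "(x, x') \<in> parcs G ^^ i \<Longrightarrow> y \<in> pverts H \<Longrightarrow> ((x, y), (x', y)) \<in> parcs (G \<box> H) ^^ i"
  by (induction i arbitrary: x') (auto simp: cart_prod_def intro!: relcompI)

lemma relpow_cart_prodI2:
  "(y, y') \<in> parcs H ^^ j \<Longrightarrow> x \<in> pverts G \<Longrightarrow> ((x, y), (x, y')) \<in> parcs (G \<box> H) ^^ j"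
  by (induction j arbitrary: y') (auto simp: cart_prod_def intro!: relcompI)

lemma rdist_cart_prod:
  assumes "(x, x') \<in> (parcs G)\<^sup>*" "(y, y') \<in> (parcs H)\<^sup>*" "x' \<in> pverts G" "y \<in> pverts H"
  shows "rdist (parcs (G \<box> H)) (x, y) (x', y') = rdist (parcs G) x x' + rdist (parcs H) y y'"
    and "((x, y), (x', y')) \<in> (parcs (G \<box> H))\<^sup>*"
proof -
  have "((x, y), (x', y')) \<in> parcs (G \<box> H) ^^ (rdist (parcs G) x x' + rdist (parcs H) y y')"
    unfolding relpow_add
    using relpow_cart_prodI1[OF rdist_relpow[OF assms(1)] assms(4)]
      relpow_cart_prodI2[OF rdist_relpow[OF assms(2)] assms(3)] by blast
  then show star: "((x, y), (x', y')) \<in> (parcs (G \<box> H))\<^sup>*"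
    and "rdist (parcs (G \<box> H)) (x, y) (x', y') = rdist (parcs G) x x' + rdist (parcs H) y y'"
  proof -
    assume w: "((x, y), (x', y')) \<in> parcs (G \<box> H) ^^ (rdist (parcs G) x x' + rdist (parcs H) y y')"
    then show s: "((x, y), (x', y')) \<in> (parcs (G \<box> H))\<^sup>*" by (rule relpow_imp_rtrancl)
    obtain i j where "i + j = rdist (parcs (G \<box> H)) (x, y) (x', y')" "(x, x') \<in> parcs G ^^ i" "(y, y') \<in> parcs H ^^ j"
      using relpow_cart_prodD[OF rdist_relpow[OF s]] by blast
    then show "rdist (parcs (G \<box> H)) (x, y) (x', y') = rdist (parcs G) x x' + rdist (parcs H) y y'"
      using rdist_le[OF w] rdist_le[of x x' i "parcs G"] rdist_le[of y y' j "parcs H"] by linarith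
  qed
qed

text \<open>The configuration outside \<open>A\<close> is arbitrary and stays untouched, so the two
  collections of a merge can be carried out one after the other.\<close>

lemma gather_imp_moves:
  assumes "gather D A v" "A \<subseteq> pverts G" "\<forall>x\<in>A. c x = 1"
    and "\<And>x y. x \<in> pverts G \<Longrightarrow> y \<in> pverts G \<Longrightarrow> D x y = graph_dist G x y"
  shows "(cup_move G)\<^sup>*\<^sup>* c (\<lambda>x. if x = v then card A else if x \<in> A then 0 else c x)"
  using assms(1-3)
proof (induction arbitrary: c rule: gather.induct)
  case (single v)
  then have "(\<lambda>x. if x = v then card {v} else if x \<in> {v} then 0 else c x) = c" by auto
  then show ?case by simp
next
  case (merge A v B u)
  let ?c1 = "\<lambda>x. if x = v then card A else if x \<in> A then 0 else c x"
  let ?c2 = "\<lambda>x. if x = u then card B else if x \<in> B then 0 else ?c1 x"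
  let ?c3 = "\<lambda>x. if x = v then card (A \<union> B) else if x \<in> A \<union> B then 0 else c x"
  have fin: "finite A" "finite B" and mem: "v \<in> A" "u \<in> B"
    using merge.hyps gather_finite gather_mem by metis+
  have uA: "u \<notin> A" "v \<notin> B" using mem merge.hyps(3) by auto
  have "(cup_move G)\<^sup>*\<^sup>* c ?c1" using merge.prems by (intro merge.IH(1)) auto
  moreover have "(cup_move G)\<^sup>*\<^sup>* ?c1 ?c2"
    using merge.prems merge.hyps(3) mem by (intro merge.IH(2)) auto
  moreover have "cup_move G ?c2 ?c3"
    unfolding cup_move_def
  proof (rule bexI[of _ u], rule bexI[of _ v], intro conjI)
    show "u \<in> pverts G" "v \<in> pverts G" using merge.prems mem by auto
    show "u \<noteq> v" using uA mem by auto
    show "1 \<le> ?c2 u" "1 \<le> ?c2 v"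
      using fin mem uA by (auto simp: Suc_le_eq card_gt_0_iff)
    show "graph_dist G u v = ?c2 u"
      using assms(4)[OF \<open>u \<in> pverts G\<close> \<open>v \<in> pverts G\<close>] merge.hyps(4) by simp
    show "?c3 = ?c2(u := 0, v := ?c2 v + ?c2 u)"
      using fin mem uA merge.hyps(3) by (auto simp: card_Un_disjoint fun_eq_iff)
  qed
  ultimately show ?case by (meson rtranclp.rtrancl_into_rtrancl rtranclp_trans)
qed

lemma stackableI:
  assumes "\<And>t. t \<in> pverts G \<Longrightarrow> clearable D t (pverts G - {t})"
    and "\<And>x y. x \<in> pverts G \<Longrightarrow> y \<in> pverts G \<Longrightarrow> D x y = graph_dist G x y"
  shows "stackable G"
  unfolding stackable_def
proof
  fix t assume t: "t \<in> pverts G"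
  have "gather D (pverts G) t"
    using clearable_imp_gather[OF assms(1)[OF t]] t by (simp add: insert_absorb)
  then have "(cup_move G)\<^sup>*\<^sup>* (initial_cups G) (\<lambda>x. if x = t then card (pverts G) else if x \<in> pverts G then 0 else initial_cups G x)"
    using assms(2) by (intro gather_imp_moves[OF \<open>gather D (pverts G) t\<close>]) (auto simp: initial_cups_def)
  then show "\<exists>c. (cup_move G)\<^sup>*\<^sup>* (initial_cups G) c \<and> (\<forall>v\<in>pverts G. v \<noteq> t \<longrightarrow> c v = 0)"
    by (intro exI conjI) auto
qed

text \<open>Squaring gives 72 * D^2 \<le> k^3; one factor \<open>k\<close> on the right is then
  bounded by \<open>D\<close> and cancelled.\<close>

lemma diameter_bound:
  fixes D k :: nat
  assumes "real D \<le> real k powr (3 / 2) / sqrt 72" "k \<le> D" "0 < k"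
  shows "72 * D \<le> k * k"
proof -
  have "(real D)\<^sup>2 \<le> (real k powr (3 / 2) / sqrt 72)\<^sup>2"
    using assms(1) by (intro power_mono) auto
  also have "\<dots> = (real k powr (3 / 2) * real k powr (3 / 2)) / 72"
    by (simp add: power_divide power2_eq_square)
  also have "real k powr (3 / 2) * real k powr (3 / 2) = real k ^ 3"
    using assms(3) by (subst powr_add[symmetric]) (simp add: powr_numeral)
  finally have "72 * (real D)\<^sup>2 \<le> real k ^ 3" by simp
  then have "real (72 * D\<^sup>2) \<le> real (k ^ 3)" by simp
  then have "72 * D\<^sup>2 \<le> k ^ 3" by (simp only: of_nat_le_iff)
  then have "72 * D * D \<le> k * k * k" by (simp add: power2_eq_square power3_eq_cube)
  also have "\<dots> \<le> k * k * D" using assms(2) by simp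
  finally show ?thesis using assms(2,3) by simp
qed

theorem theorem3p8:
  fixes T :: "'a pair_pre_digraph" and k :: nat
  assumes "is_tree T"
    and "spread T = k"
    and "72 \<le> k"
    and "real (graph_diameter T) \<le> real k powr (3 / 2) / sqrt 72"
  shows "stackable (T \<box> T \<box> T)"
proof -
  interpret finite_tree "pverts T" "parcs T" by (rule finite_tree_of_is_tree[OF assms(1)])
  let ?V = "pverts T" and ?E = "parcs T"
  define h where "h = (k + 1) div 2"
  have kh: "k \<le> 2 * h" "2 * h \<le> k + 1" "36 \<le> h" using assms(3) unfolding h_def by linarith+
  have spread: "k \<le> d u v" if "leaf T u" "leaf T v" "u \<noteq> v" for u v
  proof -
    have "graph_dist T u v \<in> {graph_dist T u v | u v. leaf T u \<and> leaf T v \<and> u \<noteq> v}"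
      using that by blast
    then have "spread T \<le> graph_dist T u v"
      unfolding spread_def by (rule cInf_lower) (auto intro: bdd_belowI[of _ 0])
    then show ?thesis using graph_dist_eq_rdist[of u T v] that(1) assms(2) by (simp add: leaf_def)
  qed
  have diam: "d x y \<le> graph_diameter T" if "x \<in> ?V" "y \<in> ?V" for x y
  proof -
    have "{graph_dist T u v | u v. u \<in> ?V \<and> v \<in> ?V} = (\<lambda>(u, v). graph_dist T u v) ` (?V \<times> ?V)" by auto
    then have "finite {graph_dist T u v | u v. u \<in> ?V \<and> v \<in> ?V}" using finite_V by simp
    then have "graph_dist T x y \<le> graph_diameter T"
      unfolding graph_diameter_def using that by (intro Max_ge) auto
    then show ?thesis using graph_dist_eq_rdist[OF that(1)] by simp
  qed
  have leaves: "\<exists>w. leaf T w \<and> w \<noteq> t" if t: "t \<in> ?V" and "?V \<noteq> {t}" for t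
  proof -
    interpret rooted_tree ?V ?E t by unfold_locales (rule t)
    show ?thesis using leaf_exists[OF that(2)] by (simp add: leaf_iff tleaf_def)
  qed
  have paths: "\<exists>f l L J g n e. tree_paths ?V ?E k h t f l L J g n e" if t: "t \<in> ?V" "?V \<noteq> {t}" for t
  proof -
    interpret rooted_tree ?V ?E t by unfold_locales (rule t)
    interpret spread_tree ?V ?E t k h
    proof
      show "k \<le> d u v" if "tleaf u" "tleaf v" "u \<noteq> v" for u v
        using spread that by (simp add: leaf_iff tleaf_def)
    qed (use kh t assms(3) in auto)
    show ?thesis by (rule tree_paths_exist)
  qed
  have V3: "pverts (T \<box> T \<box> T) = ?V \<times> ?V \<times> ?V" by (simp add: cart_prod_def)
  show ?thesis
  proof (rule stackableI[where D = d3])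
    show "d3 x y = graph_dist (T \<box> T \<box> T) x y"
      if xy: "x \<in> pverts (T \<box> T \<box> T)" "y \<in> pverts (T \<box> T \<box> T)" for x y
    proof -
      obtain x1 x2 x3 where x: "x = (x1, x2, x3)" "x1 \<in> ?V" "x2 \<in> ?V" "x3 \<in> ?V" using xy(1) V3 by auto
      obtain y1 y2 y3 where y: "y = (y1, y2, y3)" "y1 \<in> ?V" "y2 \<in> ?V" "y3 \<in> ?V" using xy(2) V3 by auto
      note prod23 = rdist_cart_prod[OF conn[OF x(3) y(3)] conn[OF x(4) y(4)] y(3) x(4)]
      have "(x2, x3) \<in> pverts (T \<box> T)" using x by (simp add: cart_prod_def)
      from rdist_cart_prod(1)[OF conn[OF x(2) y(2)] prod23(2) y(2) this] prod23(1)
      show ?thesis using graph_dist_eq_rdist[OF xy(1), of y] by (simp add: x(1) y(1) d3_def d2_def)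
    qed
    fix t assume "t \<in> pverts (T \<box> T \<box> T)"
    then obtain t1 t2 t3 where t: "t = (t1, t2, t3)" "t1 \<in> ?V" "t2 \<in> ?V" "t3 \<in> ?V" using V3 by auto
    show "clearable d3 t (pverts (T \<box> T \<box> T) - {t})"
    proof (cases "?V = {t1}")
      \<comment> \<open>In this case \<^term>\<open>spread T\<close> is the unspecified value \<^term>\<open>Inf {} :: nat\<close>, so the
        hypotheses do not exclude it.\<close>
      case True
      then have "pverts (T \<box> T \<box> T) - {t} = {}" using t V3 by auto
      then show ?thesis by (simp only: clearable.empty)
    next
      case False
      \<comment> \<open>Applying \<open>leaves\<close> twice produces two distinct leaves, whose
        distance shows that the diameter is at least \<open>k\<close>.\<close>
      then obtain u where u: "leaf T u" "u \<noteq> t1" using leaves t(2) by blast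
      then have "u \<in> ?V" "?V \<noteq> {u}" using t(2) by (auto simp: leaf_def)
      then obtain v where v: "leaf T v" "v \<noteq> u" using leaves by blast
      have ne: "?V \<noteq> {x}" for x using u v by (auto simp: leaf_def)
      have "k \<le> d v u" using spread u v by blast
      also have "\<dots> \<le> graph_diameter T" using diam u v by (simp add: leaf_def)
      finally have "72 * graph_diameter T \<le> k * k" using assms(3,4) by (intro diameter_bound) auto
      also have "\<dots> \<le> (2 * h) * (2 * h)" using kh(1) by (intro mult_le_mono)
      finally have D: "18 * graph_diameter T \<le> h * h" by simp
      obtain f1 l1 L1 J1 g1 n1 e1 where 1: "tree_paths ?V ?E k h t1 f1 l1 L1 J1 g1 n1 e1"
        using paths[OF t(2) ne] by blast
      obtain f2 l2 L2 J2 g2 n2 e2 where 2: "tree_paths ?V ?E k h t2 f2 l2 L2 J2 g2 n2 e2"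
        using paths[OF t(3) ne] by blast
      obtain f3 l3 L3 J3 g3 n3 e3 where 3: "tree_paths ?V ?E k h t3 f3 l3 L3 J3 g3 n3 e3"
        using paths[OF t(4) ne] by blast
      show ?thesis
        unfolding V3 t(1) by (rule cube_clearable[OF 1 2 3 diam kh(3) D])
    qed
  qed
qed

end
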